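(* Let $\omega=\exp(i\sigma)$ be a point of the unit circle, $\omega\ne-1$, and let $\Phi_n$, $n=0,1,\dots,N+1$, be the monic polynomials orthogonal on the unit circle with the linear Verblunsky coefficients $$a_n=\frac{\omega+1}{N+1}(n+1)-1,\qquad n=0,1,\dots,N.$$ Then the roots $z_s=\exp(i\theta_s)$ of the polynomial $\Phi_{N+1}(z)$ can be found from the transcendental equation $$\cos(\theta_s/2)=\left(\frac{2s}{N+1}-1\right)\cos(\sigma/2),\qquad s=0,1,\dots,N.$$ The (non-normalized) weights $w_s$ in the orthogonality relation of the polynomials $\Phi_0,\dots,\Phi_N$ on the points $z_s$ are given by the expression $$w_s=\frac{1}{s!\,(N+1-s)!}\left|\frac{\exp(i\theta_s)-\exp(i\sigma)}{\exp(i\theta_s)-1}\right|=\frac{1}{s!\,(N+1-s)!}\left|\frac{\sin\left(\theta_s/2-\sigma/2\right)}{\sin(\theta_s/2)}\right|.$$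
   Context: The polynomials $\Phi_n$ are defined by $\Phi_0=1$ and $\Phi_{n+1}(z)=z\Phi_n(z)-\overline{a_n}\,\Phi_n^*(z)$ for $n=0,\dots,N$, where $\Phi_n^*(z)=z^n\overline{\Phi}_n(1/z)$ and $\overline{\Phi}_n$ is obtained from $\Phi_n$ by complex conjugation of its coefficients. Here $|a_n|<1$ for $n=0,\dots,N-1$ and $a_N=\omega$, so $\Phi_{N+1}$ has $N+1$ distinct roots $z_0,\dots,z_N$, all on the unit circle. The orthogonality relation is $\sum_{s=0}^N w_s\Phi_n(z_s)\overline{\Phi}_m(z_s^{-1})=h_n\delta_{nm}$, $0\le n,m\le N$, with $h_0=1$, $h_n=\prod_{k=0}^{n-1}(1-|a_k|^2)$, when the weights are normalized by $\sum_s w_s=1$; "non-normalized" means that the weights are given up to a common factor independent of $s$.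
   Formalization: The angles θ_s are taken in the same closed period [2πk, 2πk+2π] that contains σ, since the cosine equation alone fixes z_s only up to conjugation; for ω = 1 and s = 0, where the weight expression is 0/0, the weight is its limit as σ is approached from the right. *)

theory Defs
  imports "HOL-Analysis.Analysis" "HOL-Computational_Algebra.Computational_Algebra"
begin

text \<open>
  The polynomials attached to Verblunsky coefficients \<open>a\<close>.  The reversed polynomial
  \<open>\<Phi>\<^sub>n\<^sup>*(z) = z^n \<Phi>\<^sub>n-bar(1/z)\<close> is rendered by \<^const>\<open>reflect_poly\<close>, which reverses with
  respect to the actual degree; that degree is \<open>n\<close> (lemma \<open>opuc_degree\<close>), so this is the
  usual reversal (lemma \<open>opuc_star\<close>).
\<close>

fun opuc :: "(nat \<Rightarrow> complex) \<Rightarrow> nat \<Rightarrow> complex poly" where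
  "opuc a 0 = 1"
| "opuc a (Suc n) =
     [:0, 1:] * opuc a n - smult (cnj (a n)) (reflect_poly (map_poly cnj (opuc a n)))"

lemma opuc_monic: "degree (opuc a n) = n \<and> coeff (opuc a n) n = 1"
proof (induction n)
  case 0
  show ?case by simp
next
  case (Suc n)
  let ?p = "opuc a n"
  let ?q = "smult (cnj (a n)) (reflect_poly (map_poly cnj ?p))"
  have d: "degree (map_poly cnj ?p) = n"
    by (subst degree_map_poly) (auto simp: Suc)
  have q: "degree ?q < Suc n"
    using degree_smult_le[of "cnj (a n)" "reflect_poly (map_poly cnj ?p)"]
      degree_reflect_poly_le[of "map_poly cnj ?p"] d
    by linarith
  have c: "coeff (opuc a (Suc n)) (Suc n) = 1"
    using Suc coeff_eq_0[OF q] by simp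
  have "degree (opuc a (Suc n)) \<le> Suc n"
    using q Suc degree_pCons_le[of 0 ?p]
    by (simp del: degree_smult_eq) (intro degree_diff_le, auto)
  with c le_degree[of "opuc a (Suc n)" "Suc n"] show ?case by force
qed

lemma opuc_degree: "degree (opuc a n) = n"
  using opuc_monic by blast

lemma opuc_star:
  assumes "z \<noteq> 0"
  shows "poly (reflect_poly (map_poly cnj (opuc a n))) z =
           z ^ n * poly (map_poly cnj (opuc a n)) (1 / z)"
proof -
  have "degree (map_poly cnj (opuc a n)) = n"
    by (subst degree_map_poly) (auto simp: opuc_degree)
  with assms show ?thesis
    by (simp add: poly_reflect_poly_nz inverse_eq_divide)
qed

definition opuc_orthogonality ::
    "(nat \<Rightarrow> complex) \<Rightarrow> nat \<Rightarrow> (nat \<Rightarrow> complex) \<Rightarrow> (nat \<Rightarrow> real) \<Rightarrow> bool" where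
  "opuc_orthogonality a N z w \<longleftrightarrow>
     (\<forall>n\<le>N. \<forall>m\<le>N.
        (\<Sum>s\<le>N. of_real (w s) * poly (opuc a n) (z s) *
                   poly (map_poly cnj (opuc a m)) (inverse (z s))) =
        (if n = m then of_real (\<Prod>k<n. 1 - (cmod (a k))\<^sup>2) else 0))"

text \<open>
  The equation \<open>cos (\<theta>/2) = c\<close> determines \<open>exp (i \<theta>)\<close> only up to complex conjugation, and
  \<open>cos (\<sigma>/2)\<close> depends on the choice of the argument \<open>\<sigma>\<close> of \<open>\<omega>\<close>.  Both ambiguities are
  removed by taking \<open>\<theta>\<close> and \<open>\<sigma>\<close> in the same period: for \<open>0 \<le> \<sigma> < 2 * pi\<close>, the angle \<open>\<theta>\<close>
  is sought in \<open>[0, 2 * pi]\<close>.  The right endpoint is needed for \<open>\<sigma> = 0\<close>, where the angle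
  for \<open>s = 0\<close> is \<open>2 * pi\<close>.
\<close>

definition root_angle_eq :: "nat \<Rightarrow> real \<Rightarrow> nat \<Rightarrow> real \<Rightarrow> bool" where
  "root_angle_eq N \<sigma> s t \<longleftrightarrow>
     2 * pi * \<lfloor>\<sigma> / (2 * pi)\<rfloor> \<le> t \<and> t \<le> 2 * pi * \<lfloor>\<sigma> / (2 * pi)\<rfloor> + 2 * pi \<and>
     cos (t / 2) = (2 * real s / (real N + 1) - 1) * cos (\<sigma> / 2)"

definition root_angle :: "nat \<Rightarrow> real \<Rightarrow> nat \<Rightarrow> real" where
  "root_angle N \<sigma> s = (THE t. root_angle_eq N \<sigma> s t)"

definition root_point :: "nat \<Rightarrow> real \<Rightarrow> nat \<Rightarrow> complex" where
  "root_point N \<sigma> s = exp (\<i> * of_real (root_angle N \<sigma> s))"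

definition weight_exp :: "nat \<Rightarrow> real \<Rightarrow> nat \<Rightarrow> real" where
  "weight_exp N \<sigma> s =
     1 / (fact s * fact (N + 1 - s)) *
     cmod ((exp (\<i> * of_real (root_angle N \<sigma> s)) - exp (\<i> * of_real \<sigma>)) /
           (exp (\<i> * of_real (root_angle N \<sigma> s)) - 1))"

definition weight_sin :: "nat \<Rightarrow> real \<Rightarrow> nat \<Rightarrow> real" where
  "weight_sin N \<sigma> s =
     1 / (fact s * fact (N + 1 - s)) *
     \<bar>sin (root_angle N \<sigma> s / 2 - \<sigma> / 2) / sin (root_angle N \<sigma> s / 2)\<bar>"

text \<open>
  For \<open>exp (i \<sigma>) = 1\<close> and \<open>s = 0\<close> (and in no other case with \<open>exp (i \<sigma>) \<noteq> -1\<close>) the quotient in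
  the weight is \<open>0/0\<close>.  The weight is then the limit of the expression as the parameter
  tends to \<open>\<sigma>\<close>, not the value given by the convention \<open>0/0 = 0\<close>.  The limit is taken from
  the right because the period containing \<open>\<sigma>\<close> starts at \<open>\<sigma>\<close>.
\<close>

definition circle_weight :: "nat \<Rightarrow> real \<Rightarrow> nat \<Rightarrow> real" where
  "circle_weight N \<sigma> s =
     (if root_point N \<sigma> s = 1 then Lim (at_right \<sigma>) (\<lambda>t. weight_exp N t s)
      else weight_exp N \<sigma> s)"

end

theory Submission
  imports Defs
begin

text \<open>
  Put \<open>M = N + 1\<close>, \<open>\<omega> = exp (2 i \<beta>)\<close>, \<open>z = \<zeta>^2\<close> and \<open>\<mu> = 2 cos \<beta> / M\<close>.  The coefficients are
  \<open>\<mu> exp (i \<beta>) (n + 1) - 1\<close>, and the polynomials \<open>Q\<^sub>0 = 1\<close>, \<open>Q\<^bsub>n+1\<^esub> = z \<Phi>\<^sub>n + \<Phi>\<^sub>n\<^sup>*\<close> satisfy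
  \<open>Q\<^bsub>n+2\<^esub> = (z + 1) Q\<^bsub>n+1\<^esub> - (n + 1) (M - n) \<mu>^2 z Q\<^sub>n\<close>, which after division by \<open>\<zeta>^n\<close> is the
  recurrence of symmetric Krawtchouk polynomials.  At \<open>z\<^sub>s\<close> the Krawtchouk argument is the integer
  \<open>s\<close>, and \<open>(\<omega> - z) \<Phi>\<^sub>n = \<mu> exp (i \<beta>) (M - n) Q\<^sub>n - Q\<^bsub>n+1\<^esub>\<close>.  For \<open>n = M\<close> the right-hand side vanishes
  at the \<open>z\<^sub>s\<close>, which gives the roots.  For the weights, the sum over \<open>s \<le> M\<close> of the binomial
  coefficient times \<open>(z\<^sub>s - \<omega>) / (z\<^sub>s - 1) \<Phi>\<^sub>n(z\<^sub>s)\<close> splits into sums of a Krawtchouk polynomial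
  against \<open>\<zeta>\<^sub>s^j / sin\<close>, whose imaginary part is zero by Krawtchouk orthogonality and whose real part
  is zero by the reflection \<open>s \<mapsto> M - s\<close>.  The term \<open>s = M\<close> has \<open>z\<^sub>s = \<omega>\<close> and drops out.  The case
  \<open>\<omega> = 1\<close> follows by letting \<open>\<beta>\<close> tend to \<open>0\<close>.
\<close>

subsection \<open>Krawtchouk polynomials\<close>

text \<open>The Krawtchouk polynomial for parameter 1/2, read off from its generating function. The
  orientation is chosen so that degree 1 gives 2s - M, as in the cosine equation of the
  nodes.\<close>

definition krawtchouk :: "nat \<Rightarrow> nat \<Rightarrow> nat \<Rightarrow> real" where
  "krawtchouk M n s = coeff ([:1, 1:] ^ s * [:1, -1:] ^ (M - s)) n"

text \<open>The logarithmic derivative of \<open>G\<close> is s/(1 + t) - (M - s)/(1 - t). Clearing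
  denominators gives a first-order equation whose coefficients yield the recurrence in n.\<close>

lemma krawtchouk_ode:
  fixes M s :: nat
  assumes "s \<le> M"
  defines "G \<equiv> [:1, 1:] ^ s * [:1, -1:] ^ (M - s) :: real poly"
  shows "[:1, 0, -1:] * pderiv G = [:2 * real s - real M, - real M:] * G"
proof -
  define A B :: "real poly" where "A = [:1, 1:]" and "B = [:1, -1:]"
  have power_ode: "p * pderiv (p ^ k) = smult (real k) (pderiv p * p ^ k)" for p :: "real poly" and k
  proof (cases k)
    case (Suc m)
    then show ?thesis
      by (simp only: pderiv_power_Suc mult_smult_right) (simp add: mult_ac)
  qed simp
  have dA: "pderiv A = 1" and dB: "pderiv B = -1"
    by (simp_all add: A_def B_def pderiv_pCons one_pCons)
  have "[:1, 0, -1:] * pderiv G =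
      (A * B) * (A ^ s * pderiv (B ^ (M - s)) + B ^ (M - s) * pderiv (A ^ s))"
    unfolding G_def A_def[symmetric] B_def[symmetric] pderiv_mult
    by (simp add: A_def B_def)
  also have "\<dots> = A * A ^ s * (B * pderiv (B ^ (M - s))) + B * B ^ (M - s) * (A * pderiv (A ^ s))"
    by (simp add: algebra_simps)
  also have "\<dots> = (smult (real s) B - smult (real (M - s)) A) * (A ^ s * B ^ (M - s))"
    unfolding power_ode dA dB by (simp add: algebra_simps)
  also have "smult (real s) B - smult (real (M - s)) A = [:2 * real s - real M, - real M:]"
    using assms(1) by (simp add: A_def B_def of_nat_diff)
  finally show ?thesis by (simp add: G_def A_def B_def)
qed

lemma krawtchouk_0 [simp]: "krawtchouk M 0 s = 1"
  by (simp add: krawtchouk_def coeff_mult coeff_0_power)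

lemma krawtchouk_1:
  assumes "s \<le> M"
  shows "krawtchouk M (Suc 0) s = 2 * real s - real M"
  using arg_cong[OF krawtchouk_ode[OF assms], of "\<lambda>p. coeff p 0"] krawtchouk_0[of M s]
  by (simp add: krawtchouk_def coeff_pderiv)

lemma krawtchouk_rec:
  assumes "s \<le> M"
  shows "(real n + 2) * krawtchouk M (n + 2) s =
           (2 * real s - real M) * krawtchouk M (n + 1) s - (real M - real n) * krawtchouk M n s"
  using arg_cong[OF krawtchouk_ode[OF assms], of "\<lambda>p. coeff p (Suc n)"]
  by (simp add: krawtchouk_def coeff_pderiv coeff_pCons algebra_simps split: nat.splits)

text \<open>The generating polynomial has degree at most M. The case n = M + 1 is what makes the
  nodes roots.\<close>

lemma krawtchouk_eq_0:
  assumes "s \<le> M" "M < n"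
  shows "krawtchouk M n s = 0"
proof -
  have "degree ([:1, 1:] ^ s * [:1, -1:] ^ (M - s) :: real poly) \<le> s * 1 + (M - s) * 1"
    by (intro order.trans[OF degree_mult_le] add_mono order.trans[OF degree_power_le])
      (auto)
  then show ?thesis
    using assms by (simp add: krawtchouk_def coeff_eq_0)
qed

text \<open>Exchanging s and M - s replaces t by -t in the generating function. The proof propagates
  the sign through the three-term recurrence, hence two consecutive degrees.\<close>

lemma krawtchouk_reflect:
  assumes "s \<le> M"
  shows "krawtchouk M n (M - s) = (-1) ^ n * krawtchouk M n s"
proof -
  have "krawtchouk M n (M - s) = (-1) ^ n * krawtchouk M n s \<and>
        krawtchouk M (Suc n) (M - s) = (-1) ^ Suc n * krawtchouk M (Suc n) s"
  proof (induction n)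
    case 0
    then show ?case using assms by (simp add: krawtchouk_1 of_nat_diff)
  next
    case (Suc n)
    have "(real n + 2) * krawtchouk M (n + 2) (M - s) = (real n + 2) * ((-1) ^ n * krawtchouk M (n + 2) s)"
    proof -
      have "(real n + 2) * ((-1) ^ n * krawtchouk M (n + 2) s) =
          (-1) ^ n * ((2 * real s - real M) * krawtchouk M (n + 1) s - (real M - real n) * krawtchouk M n s)"
        unfolding krawtchouk_rec[OF assms, symmetric] by simp
      then show ?thesis
        using krawtchouk_rec[of "M - s" M n] assms Suc by (simp add: of_nat_diff algebra_simps)
    qed
    then have "krawtchouk M (n + 2) (M - s) = (-1) ^ n * krawtchouk M (n + 2) s"
      by (simp only: mult_cancel_left) linarith
    then show ?case using Suc by simp
  qed
  then show ?thesis ..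
qed

text \<open>The binomial theorem sums the generating functions to ((1 + t) + (1 - t))^M = 2^M, a
  constant in t.\<close>

lemma krawtchouk_sum:
  assumes "0 < n"
  shows "(\<Sum>s\<le>M. real (M choose s) * krawtchouk M n s) = 0"
proof -
  have "(\<Sum>s\<le>M. real (M choose s) * krawtchouk M n s) =
          coeff (\<Sum>s\<le>M. of_nat (M choose s) * [:1, 1:] ^ s * [:1, -1:] ^ (M - s)) n"
    by (simp add: krawtchouk_def coeff_sum of_nat_poly mult.assoc)
  also have "\<dots> = coeff (([:1, 1:] + [:1, -1:] :: real poly) ^ M) n"
    by (subst binomial_ring) simp
  also have "([:1, 1:] + [:1, -1:] :: real poly) = [:2:]"
    by simp
  also have "coeff ([:2::real:] ^ M) n = 0"
    using assms by (simp add: poly_const_pow coeff_pCons split: nat.splits)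
  finally show ?thesis .
qed

text \<open>For j > 0 the quotient of sines is a Chebyshev polynomial of degree j - 1 in the cosine,
  hence in s, so this is orthogonality to lower degrees. The Chebyshev recurrence multiplies by 2s -
  M, and the Krawtchouk recurrence trades that factor for a shift of n.\<close>

lemma krawtchouk_sum_sin:
  assumes cos: "\<And>s. s \<le> M \<Longrightarrow> 2 * cos (\<phi> s) = \<mu> * (2 * real s - real M)"
    and sin: "\<And>s. s \<le> M \<Longrightarrow> sin (\<phi> s) \<noteq> 0"
    and "j \<le> n"
  shows "(\<Sum>s\<le>M. real (M choose s) * krawtchouk M n s * (sin (real j * \<phi> s) / sin (\<phi> s))) = 0"
proof -
  define T where
    "T n j = (\<Sum>s\<le>M. real (M choose s) * krawtchouk M n s * (sin (real j * \<phi> s) / sin (\<phi> s)))" for n j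
  \<comment> \<open>All n at once, since the step for n calls on n - 1 and n + 1; two consecutive j,
    for the Chebyshev recurrence.\<close>
  have "\<forall>n. (j \<le> n \<longrightarrow> T n j = 0) \<and> (Suc j \<le> n \<longrightarrow> T n (Suc j) = 0)" for j
  proof (induction j)
    case 0
    have "T n (Suc 0) = (\<Sum>s\<le>M. real (M choose s) * krawtchouk M n s)" for n
      unfolding T_def by (intro sum.cong) (auto simp: sin)
    then show ?case by (auto simp: T_def krawtchouk_sum)
  next
    case (Suc j)
    have "T n (Suc (Suc j)) = 0" if "Suc (Suc j) \<le> n" for n
    proof -
      obtain m where m: "n = Suc m" "Suc j \<le> m"
        using \<open>Suc (Suc j) \<le> n\<close> Suc_le_D that by blast
      have "real (M choose s) * krawtchouk M n s * (sin (real (Suc (Suc j)) * \<phi> s) / sin (\<phi> s)) =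
            \<mu> * (real m + 2) * (real (M choose s) * krawtchouk M (m + 2) s * (sin (real (Suc j) * \<phi> s) / sin (\<phi> s)))
          + \<mu> * (real M - real m) * (real (M choose s) * krawtchouk M m s * (sin (real (Suc j) * \<phi> s) / sin (\<phi> s)))
          - real (M choose s) * krawtchouk M n s * (sin (real j * \<phi> s) / sin (\<phi> s))"
        if s: "s \<le> M" for s
      proof -
        have "sin (real (Suc (Suc j)) * \<phi> s) = sin (real (Suc j) * \<phi> s + \<phi> s)"
          "sin (real j * \<phi> s) = sin (real (Suc j) * \<phi> s - \<phi> s)"
          by (simp_all add: algebra_simps)
        then have "sin (real (Suc (Suc j)) * \<phi> s) =
            2 * cos (\<phi> s) * sin (real (Suc j) * \<phi> s) - sin (real j * \<phi> s)"
          by (simp only: sin_add sin_diff) simp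
        then have 1: "sin (real (Suc (Suc j)) * \<phi> s) =
            \<mu> * (2 * real s - real M) * sin (real (Suc j) * \<phi> s) - sin (real j * \<phi> s)"
          by (simp only: cos[OF s])
        have 2: "(2 * real s - real M) * krawtchouk M n s =
            (real m + 2) * krawtchouk M (m + 2) s + (real M - real m) * krawtchouk M m s"
          using krawtchouk_rec[OF s, of m] m by simp
        have "krawtchouk M n s * sin (real (Suc (Suc j)) * \<phi> s) =
            \<mu> * ((2 * real s - real M) * krawtchouk M n s) * sin (real (Suc j) * \<phi> s)
            - krawtchouk M n s * sin (real j * \<phi> s)"
          unfolding 1 by (simp add: algebra_simps)
        also note 2
        finally have "krawtchouk M n s * sin (real (Suc (Suc j)) * \<phi> s) =
            \<mu> * ((real m + 2) * krawtchouk M (m + 2) s + (real M - real m) * krawtchouk M m s)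
              * sin (real (Suc j) * \<phi> s)
            - krawtchouk M n s * sin (real j * \<phi> s)" .
        moreover have "C * K * (S / d) =
            \<mu> * p * (C * K2 * (A / d)) + \<mu> * q * (C * K0 * (A / d)) - C * K * (B / d)"
          if "K * S = \<mu> * (p * K2 + q * K0) * A - K * B" for C K S d p q A B K0 K2 :: real
        proof -
          have "C * K * (S / d) = C * (K * S) / d" by simp
          then show ?thesis unfolding that
            by (simp add: algebra_simps add_divide_distrib diff_divide_distrib)
        qed
        ultimately show ?thesis by blast
      qed
      then have "T n (Suc (Suc j)) = \<mu> * (real m + 2) * T (m + 2) (Suc j)
          + \<mu> * (real M - real m) * T m (Suc j) - T n j"
        by (simp add: T_def sum_distrib_left sum.distrib sum_subtractf)
      then show ?thesis
        using Suc m by simp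
    qed
    with Suc show ?case by blast
  qed
  then show ?thesis
    using \<open>j \<le> n\<close> by (simp add: T_def)
qed

text \<open>Under the reflection the binomial coefficient and the sine are unchanged, while the
  other two factors acquire (-1)^n and (-1)^j. For n + j odd the sum is its own negative.\<close>

lemma krawtchouk_sum_cos:
  assumes refl: "\<And>s. s \<le> M \<Longrightarrow> \<phi> (M - s) = pi - \<phi> s"
    and "odd (n + j)"
  shows "(\<Sum>s\<le>M. real (M choose s) * krawtchouk M n s * (cos (real j * \<phi> s) / sin (\<phi> s))) = 0"
proof -
  let ?f = "\<lambda>s. real (M choose s) * krawtchouk M n s * (cos (real j * \<phi> s) / sin (\<phi> s))"
  have "?f (M - s) = - ?f s" if s: "s \<le> M" for s
  proof -
    have "cos (real j * \<phi> (M - s)) = cos (real j * pi - real j * \<phi> s)"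
      by (simp add: refl[OF s] right_diff_distrib)
    also have "\<dots> = (-1) ^ j * cos (real j * \<phi> s)"
      by (simp add: cos_diff)
    finally have "cos (real j * \<phi> (M - s)) = (-1) ^ j * cos (real j * \<phi> s)" .
    moreover have "sin (\<phi> (M - s)) = sin (\<phi> s)"
      by (simp add: refl[OF s])
    moreover have "(-1::real) ^ n * (-1) ^ j = -1"
      using \<open>odd (n + j)\<close> by (simp flip: power_add)
    moreover have "?f (M - s) = ((-1) ^ n * (-1) ^ j) * ?f s"
      unfolding calculation(1,2)
      by (simp add: krawtchouk_reflect[OF s] binomial_symmetric[OF s, symmetric])
    ultimately show ?thesis by (simp only: mult_minus1)
  qed
  then have "sum ?f {..M} = - sum ?f {..M}"
    using sum.atLeastAtMost_rev[of ?f 0 M] by (simp add: atLeast0AtMost sum_negf)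
  then show ?thesis by simp
qed

text \<open>The real part vanishes by parity and the imaginary part by degree, hence the two
  conditions on j.\<close>

lemma krawtchouk_sum_cis:
  assumes cos: "\<And>s. s \<le> M \<Longrightarrow> 2 * cos (\<phi> s) = \<mu> * (2 * real s - real M)"
    and sin: "\<And>s. s \<le> M \<Longrightarrow> sin (\<phi> s) \<noteq> 0"
    and refl: "\<And>s. s \<le> M \<Longrightarrow> \<phi> (M - s) = pi - \<phi> s"
    and "j \<le> n" "odd (n + j)"
  shows "(\<Sum>s\<le>M. of_nat (M choose s) * of_real (krawtchouk M n s) *
            (cis (\<phi> s) ^ j / of_real (sin (\<phi> s)))) = 0"
proof -
  have cis_pow: "cis (\<phi> s) ^ j = Complex (cos (real j * \<phi> s)) (sin (real j * \<phi> s))" for s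
    by (simp only: Complex.DeMoivre) (simp add: complex_eq_iff)
  have "(\<Sum>s\<le>M. of_nat (M choose s) * of_real (krawtchouk M n s) *
            (cis (\<phi> s) ^ j / of_real (sin (\<phi> s)))) =
     Complex (\<Sum>s\<le>M. real (M choose s) * krawtchouk M n s * (cos (real j * \<phi> s) / sin (\<phi> s)))
       (\<Sum>s\<le>M. real (M choose s) * krawtchouk M n s * (sin (real j * \<phi> s) / sin (\<phi> s)))"
    by (simp add: complex_eq_iff cis_pow)
  also have "\<dots> = 0"
    using krawtchouk_sum_sin[of M \<phi>, OF cos sin \<open>j \<le> n\<close>] krawtchouk_sum_cos[of M \<phi>, OF refl \<open>odd (n + j)\<close>]
    by (simp add: complex_eq_iff)
  finally show ?thesis .
qed

subsection \<open>Orthogonality on the unit circle\<close>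

definition opuc_star :: "(nat \<Rightarrow> complex) \<Rightarrow> nat \<Rightarrow> complex poly" where
  "opuc_star a n = reflect_poly (map_poly cnj (opuc a n))"

lemma poly_opuc_Suc:
  "poly (opuc a (Suc n)) z = z * poly (opuc a n) z - cnj (a n) * poly (opuc_star a n) z"
  by (simp add: opuc_star_def)

lemma poly_opuc_star:
  assumes "cmod z = 1"
  shows "poly (opuc_star a n) z = z ^ n * cnj (poly (opuc a n) z)"
proof -
  have "cnj (1 / z) = z" "z \<noteq> 0"
    using assms by (auto simp: complex_cnj_divide divide_conv_cnj)
  then show ?thesis
    by (simp add: opuc_star_def Defs.opuc_star)
qed

text \<open>The companion Szego recurrence. On the circle reversal is z^n times conjugation, so it
  is the conjugate of the first recurrence multiplied by z^(n+1).\<close>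

lemma poly_opuc_star_Suc:
  assumes "cmod z = 1"
  shows "poly (opuc_star a (Suc n)) z = poly (opuc_star a n) z - a n * z * poly (opuc a n) z"
proof -
  have "z * cnj z = 1"
    using assms by (simp add: complex_norm_square[symmetric])
  then have "z ^ n * cnj z ^ n = 1"
    by (simp flip: power_mult_distrib)
  then have "z ^ n * cnj (poly (opuc_star a n) z) = poly (opuc a n) z"
    by (simp add: poly_opuc_star[OF assms] flip: mult.assoc)
  moreover have "poly (opuc_star a (Suc n)) z = (z * cnj z) * (z ^ n * cnj (poly (opuc a n) z)) -
      a n * z * (z ^ n * cnj (poly (opuc_star a n) z))"
    unfolding poly_opuc_star[OF assms, of a "Suc n"] poly_opuc_Suc by (simp add: algebra_simps)
  ultimately show ?thesis
    using \<open>z * cnj z = 1\<close> by (simp only: poly_opuc_star[OF assms, of a n, symmetric] mult_1)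
qed

text \<open>The scalar product of \<open>\<Phi>\<^bsub>n+1\<^esub>\<close> with \<open>z^k\<close>, \<open>1 \<le> k \<le> n\<close>, vanishes by the recurrence, so the
  relations against the constants are the only independent ones.\<close>

lemma opuc_orthogonality_iff:
  assumes unit: "\<And>s. s \<le> N \<Longrightarrow> cmod (z s) = 1"
  shows "opuc_orthogonality a N z w \<longleftrightarrow>
    (\<forall>n\<le>N. (\<Sum>s\<le>N. of_real (w s) * poly (opuc a n) (z s)) = (if n = 0 then 1 else 0))"
    (is "_ \<longleftrightarrow> ?R")
proof
  assume "opuc_orthogonality a N z w"
  then have "(\<Sum>s\<le>N. of_real (w s) * poly (opuc a n) (z s) *
                   poly (map_poly cnj (opuc a 0)) (inverse (z s))) =
        (if n = 0 then of_real (\<Prod>k<n. 1 - (cmod (a k))\<^sup>2) else 0)" if "n \<le> N" for n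
    using that unfolding opuc_orthogonality_def by blast
  then show ?R by (auto split: if_splits)
next
  assume R: ?R
  define f where "f n s = poly (opuc a n) (z s)" for n s
  define g where "g n s = poly (opuc_star a n) (z s)" for n s
  define h where "h n = (\<Prod>k<n. 1 - (cmod (a k))\<^sup>2)" for n
  define I where "I u v = (\<Sum>s\<le>N. of_real (w s) * u s * cnj (v s))" for u v :: "nat \<Rightarrow> complex"
  have zz: "z s * cnj (z s) = 1" if "s \<le> N" for s
    using unit[OF that] by (simp add: complex_norm_square[symmetric])
  have cnj_I: "cnj (I u v) = I v u" for u v
    by (simp add: I_def mult_ac)
  \<comment> \<open>Multiplication by z preserves \<open>I\<close>, because the nodes lie on the
    unit circle.\<close>
  have shift: "I (\<lambda>s. z s * u s) (\<lambda>s. z s * v s) = I u v" for u v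
    unfolding I_def
  proof (rule sum.cong)
    fix s assume "s \<in> {..N}"
    then have "of_real (w s) * (z s * u s) * cnj (z s * v s) =
        (z s * cnj (z s)) * (of_real (w s) * u s * cnj (v s))"
      by (simp add: mult_ac)
    then show "of_real (w s) * (z s * u s) * cnj (z s * v s) = of_real (w s) * u s * cnj (v s)"
      using zz \<open>s \<in> {..N}\<close> by simp
  qed simp
  \<comment> \<open>Reversal exchanges the exponents k and n - k: orthogonality of \<Phi>_n to 1,
    ..., z^(n-1) becomes orthogonality of its reversal to z, ..., z^n.\<close>
  have star: "I (g n) (\<lambda>s. z s ^ k) = cnj (I (f n) (\<lambda>s. z s ^ (n - k)))" if "k \<le> n" for n k
    unfolding cnj_I unfolding I_def
  proof (rule sum.cong)
    fix s assume "s \<in> {..N}"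
    then have "z s ^ n * cnj (z s) ^ k = z s ^ (n - k) * (z s * cnj (z s)) ^ k"
      using that by (simp add: power_mult_distrib flip: power_add mult.assoc)
    then show "of_real (w s) * g n s * cnj (z s ^ k) =
        of_real (w s) * z s ^ (n - k) * cnj (f n s)"
      using \<open>s \<in> {..N}\<close> zz unit by (simp add: g_def f_def poly_opuc_star mult_ac)
  qed simp
  have diff: "I (\<lambda>s. u s - c * v s) x = I u x - c * I v x" for u v x c
    by (simp add: I_def sum_distrib_left sum_subtractf algebra_simps)
  have f_Suc: "f (Suc n) = (\<lambda>s. z s * f n s - cnj (a n) * g n s)" for n
    by (rule ext) (simp add: f_def g_def poly_opuc_Suc del: opuc.simps)
  have f_const: "I (f n) (\<lambda>s. 1) = (if n = 0 then 1 else 0)" if "n \<le> N" for n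
    using R that by (simp add: I_def f_def)
  have power: "n \<le> N \<longrightarrow> I (f n) (\<lambda>s. z s ^ n) = of_real (h n) \<and>
      (\<forall>k<n. I (f n) (\<lambda>s. z s ^ k) = 0)" for n
  proof (induction n)
    case 0
    then show ?case using f_const[of 0] by (simp add: h_def)
  next
    case (Suc n)
    show ?case
    proof (intro impI)
      assume n: "Suc n \<le> N"
      have shifted: "I (f (Suc n)) (\<lambda>s. z s ^ Suc k) =
          I (f n) (\<lambda>s. z s ^ k) - cnj (a n) * I (g n) (\<lambda>s. z s ^ Suc k)" for k
        using shift[of "f n" "\<lambda>s. z s ^ k"] by (simp add: f_Suc diff)
      have low: "I (f (Suc n)) (\<lambda>s. z s ^ k) = 0" if "k < Suc n" for k
      proof (cases k)
        case 0
        then show ?thesis using f_const[OF n] by simp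
      next
        case (Suc l)
        then have "I (f n) (\<lambda>s. z s ^ l) = 0" "I (f n) (\<lambda>s. z s ^ (n - k)) = 0"
          using Suc.IH that n by auto
        then show ?thesis
          using shifted[of l] star[of k n] Suc that by simp
      qed
      \<comment> \<open>The relation of \<Phi>_(n+1) against 1, read backwards, determines the
        product of z \<Phi>_n with 1. This supplies the factor 1 - |a_n|^2 of the norm.\<close>
      have "0 = I (\<lambda>s. z s * f n s) (\<lambda>s. 1) - cnj (a n) * I (g n) (\<lambda>s. 1)"
        using low[of 0] by (simp add: f_Suc diff)
      also have "I (g n) (\<lambda>s. 1) = of_real (h n)"
        using star[of 0 n] Suc.IH n by simp
      finally have zf: "I (\<lambda>s. z s * f n s) (\<lambda>s. 1) = cnj (a n) * of_real (h n)"
        by simp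
      have "I (g n) (\<lambda>s. z s ^ Suc n) = cnj (I (\<lambda>s. z s * f n s) (\<lambda>s. 1))"
        unfolding cnj_I unfolding I_def
      proof (rule sum.cong)
        fix s assume "s \<in> {..N}"
        then have "z s ^ n * cnj (z s) ^ n = 1"
          using zz by (simp flip: power_mult_distrib)
        then show "of_real (w s) * g n s * cnj (z s ^ Suc n) =
            of_real (w s) * 1 * cnj (z s * f n s)"
          using \<open>s \<in> {..N}\<close> zz unit by (simp add: g_def f_def poly_opuc_star mult_ac)
      qed simp
      then have "I (f (Suc n)) (\<lambda>s. z s ^ Suc n) =
          of_real (h n) - cnj (a n) * cnj (cnj (a n) * of_real (h n))"
        using shifted[of n] Suc.IH n zf by simp
      also have "\<dots> = of_real (h n) * (1 - a n * cnj (a n))"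
        by (simp add: algebra_simps)
      also have "\<dots> = of_real (h (Suc n))"
        by (simp add: h_def flip: complex_norm_square)
      finally show "I (f (Suc n)) (\<lambda>s. z s ^ Suc n) = of_real (h (Suc n)) \<and>
          (\<forall>k<Suc n. I (f (Suc n)) (\<lambda>s. z s ^ k) = 0)"
        using low by simp
    qed
  qed
  have expand: "I u (f m) = (\<Sum>i\<le>m. cnj (coeff (opuc a m) i) * I u (\<lambda>s. z s ^ i))" for u m
    by (simp add: I_def f_def poly_altdef opuc_degree sum_distrib_left sum_distrib_right mult_ac)
      (subst sum.swap, rule refl)
  have low: "I (f n) (f m) = 0" if "m < n" "n \<le> N" for m n
    using that power[of n] by (simp add: expand)
  have diag: "I (f n) (f n) = of_real (h n)" if "n \<le> N" for n
  proof -
    have "I (f n) (f n) = cnj (coeff (opuc a n) n) * I (f n) (\<lambda>s. z s ^ n)"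
      unfolding expand using that power[of n] by (subst sum.remove[of _ n]) auto
    then show ?thesis using that power[of n] by (simp add: opuc_monic)
  qed
  have "I (f n) (f m) = (if n = m then of_real (h n) else 0)" if "n \<le> N" "m \<le> N" for n m
    using low[of m n] low[of n m] cnj_I[of "f m" "f n"] diag[of n] that
    by (cases n m rule: linorder_cases) auto
  moreover have "I (f n) (f m) = (\<Sum>s\<le>N. of_real (w s) * poly (opuc a n) (z s) *
                   poly (map_poly cnj (opuc a m)) (inverse (z s)))" for n m
    unfolding I_def f_def
  proof (rule sum.cong)
    fix s assume "s \<in> {..N}"
    then have "cnj (inverse (z s)) = z s"
      using unit[of s] by (simp add: inverse_eq_divide divide_conv_cnj)
    then show "of_real (w s) * poly (opuc a n) (z s) * cnj (poly (opuc a m) (z s)) =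
      of_real (w s) * poly (opuc a n) (z s) * poly (map_poly cnj (opuc a m)) (inverse (z s))"
      by simp
  qed simp
  ultimately show "opuc_orthogonality a N z w"
    unfolding opuc_orthogonality_def by (simp add: h_def)
qed

text \<open>\<Phi>_0, ..., \<Phi>_N span the polynomials of degree at most N, so the functional
  kills the product that vanishes at every node except \<open>z r\<close>. This gives uniqueness of
  the weights.\<close>

lemma opuc_sum_eq_0_imp:
  fixes d :: "nat \<Rightarrow> complex"
  assumes sum_0: "\<And>n. n \<le> N \<Longrightarrow> (\<Sum>s\<le>N. d s * poly (opuc a n) (z s)) = 0"
    and inj: "inj_on z {..N}" and "r \<le> N"
  shows "d r = 0"
proof -
  have "(\<Sum>s\<le>N. d s * poly p (z s)) = 0" if "degree p \<le> N" for p
    using that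
  proof (induction "degree p" arbitrary: p rule: less_induct)
    case less
    define q where "q = p - smult (lead_coeff p) (opuc a (degree p))"
    have q: "(\<Sum>s\<le>N. d s * poly q (z s)) = 0"
    proof (cases "degree p = 0")
      case True
      then obtain c where "p = [:c:]" by (rule degree_eq_zeroE)
      then show ?thesis by (simp add: q_def)
    next
      case False
      have "degree q \<le> degree p"
        unfolding q_def by (intro degree_diff_le order.trans[OF degree_smult_le]) (auto simp: opuc_degree)
      moreover have "coeff q (degree p) = 0"
        by (simp add: q_def opuc_monic)
      ultimately have "degree q < degree p"
        using False by (metis degree_0 leading_coeff_0_iff le_neq_implies_less neq0_conv)
      then show ?thesis using less by simp
    qed
    have "(\<Sum>s\<le>N. d s * poly p (z s)) = (\<Sum>s\<le>N. d s * poly q (z s)) +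
        lead_coeff p * (\<Sum>s\<le>N. d s * poly (opuc a (degree p)) (z s))"
      by (simp add: q_def algebra_simps sum_subtractf sum_distrib_left)
    then show ?case using q sum_0[OF less.prems] by simp
  qed
  moreover define p where "p = (\<Prod>k\<in>{..N} - {r}. [:- z k, 1:])"
  moreover have "degree p = N"
    using \<open>r \<le> N\<close> by (simp add: p_def degree_prod_sum_eq)
  ultimately have "0 = (\<Sum>s\<le>N. d s * poly p (z s))"
    by simp
  also have "\<dots> = d r * poly p (z r)"
  proof (rule sum.remove[of "{..N}" r, THEN trans])
    have "poly p (z s) = 0" if "s \<in> {..N} - {r}" for s
      using that by (auto simp: p_def poly_prod)
    then show "d r * poly p (z r) + (\<Sum>s\<in>{..N} - {r}. d s * poly p (z s)) = d r * poly p (z r)"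
      by simp
  qed (use \<open>r \<le> N\<close> in auto)
  finally have "d r * poly p (z r) = 0" by simp
  moreover have "poly p (z r) \<noteq> 0"
    using inj \<open>r \<le> N\<close> by (auto simp: p_def poly_prod inj_on_def)
  ultimately show ?thesis by simp
qed

section \<open>Dependence on the coefficients and continuity\<close>

lemma opuc_cong:
  assumes "\<And>k. k < n \<Longrightarrow> a k = b k"
  shows "opuc a n = opuc b n"
  using assms by (induction n) auto

text \<open>On the circle the reversal is z^n times a conjugate value, hence continuous. Used to
  carry identities from \<beta> > 0 to \<beta> = 0.\<close>

lemma tendsto_poly_opuc:
  fixes a :: "'x \<Rightarrow> nat \<Rightarrow> complex"
  assumes a: "\<And>k. k < n \<Longrightarrow> ((\<lambda>x. a x k) \<longlongrightarrow> b k) F"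
    and \<theta>: "(\<theta> \<longlongrightarrow> \<theta>\<^sub>0) F"
  shows "((\<lambda>x. poly (opuc (a x) n) (cis (\<theta> x))) \<longlongrightarrow> poly (opuc b n) (cis \<theta>\<^sub>0)) F"
  using a
proof (induction n)
  case (Suc n)
  have "((\<lambda>x. cis (\<theta> x)) \<longlongrightarrow> cis \<theta>\<^sub>0) F"
    unfolding cis_conv_exp by (intro tendsto_intros \<theta>)
  with Suc show ?case
    unfolding poly_opuc_Suc by (subst (1 2) poly_opuc_star) (auto intro!: tendsto_intros)
qed simp

subsection \<open>Linear Verblunsky coefficients\<close>

text \<open>Half-angle form: for \<omega> = \<open>cis (2 * \<beta>)\<close> the sum \<omega> + 1 is
  \<open>2 * cos \<beta> * cis \<beta>\<close>. Here M stands for N + 1.\<close>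

definition linear_verblunsky :: "nat \<Rightarrow> real \<Rightarrow> nat \<Rightarrow> complex" where
  "linear_verblunsky M \<beta> n = of_real (2 * cos \<beta> / real M) * cis \<beta> * of_nat (Suc n) - 1"

text \<open>Values of the para-orthogonal polynomials, in which the last coefficient is replaced by
  -1. The value 1 at index 0 starts the three-term recurrence.\<close>

definition para_opuc :: "nat \<Rightarrow> real \<Rightarrow> complex \<Rightarrow> nat \<Rightarrow> complex" where
  "para_opuc M \<beta> z n = (case n of 0 \<Rightarrow> 1
     | Suc m \<Rightarrow> z * poly (opuc (linear_verblunsky M \<beta>) m) z + poly (opuc_star (linear_verblunsky M \<beta>) m) z)"

lemma para_opuc_0 [simp]: "para_opuc M \<beta> z 0 = 1"
  by (simp add: para_opuc_def)

text \<open>Linearity of the coefficients enters here. With e = \<open>cis \<beta>\<close>, the sum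
  e + \<open>cnj e\<close> is \<mu> M, and the coefficient terms collect to -\<mu> n Q_n because e
  times \<open>cnj e\<close> is 1.\<close>

lemma para_opuc_conv_opuc:
  fixes \<beta> :: real
  assumes z: "cmod z = 1" and "0 < M" "n \<le> M"
  defines "f \<equiv> \<lambda>n. poly (opuc (linear_verblunsky M \<beta>) n) z"
    and "g \<equiv> \<lambda>n. poly (opuc_star (linear_verblunsky M \<beta>) n) z"
    and "\<mu> \<equiv> complex_of_real (2 * cos \<beta> / real M)"
  shows "cis \<beta> * f n + cnj (cis \<beta>) * g n = \<mu> * (of_nat M - of_nat n) * para_opuc M \<beta> z n"
proof (cases n)
  case 0
  have "cis \<beta> + cnj (cis \<beta>) = of_real (2 * cos \<beta>)"
    by (simp add: complex_eq_iff)
  with 0 \<open>0 < M\<close> show ?thesis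
    by (simp add: f_def g_def opuc_star_def \<mu>_def)
next
  case (Suc m)
  define e where "e = cis \<beta>"
  have ee: "e * cnj e = 1"
    by (simp add: e_def cis_mult cis_cnj)
  have e2: "e + cnj e = \<mu> * of_nat M"
    using \<open>0 < M\<close> by (simp add: e_def \<mu>_def complex_eq_iff)
  have a: "linear_verblunsky M \<beta> m = \<mu> * e * of_nat (Suc m) - 1"
    by (simp add: linear_verblunsky_def \<mu>_def e_def)
  define Q where "Q = z * f m + g m"
  have f: "f n = Q - \<mu> * cnj e * of_nat (Suc m) * g m"
    unfolding f_def Suc poly_opuc_Suc a
    by (simp add: Q_def f_def g_def \<mu>_def algebra_simps)
  have g: "g n = Q - \<mu> * e * of_nat (Suc m) * z * f m"
    unfolding g_def Suc poly_opuc_star_Suc[OF z] a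
    by (simp add: Q_def f_def g_def \<mu>_def algebra_simps)
  have "e * f n + cnj e * g n = (e + cnj e) * Q - \<mu> * of_nat (Suc m) * (e * cnj e) * Q"
    unfolding f g by (simp add: Q_def algebra_simps)
  also have "\<dots> = \<mu> * (of_nat M - of_nat n) * Q"
    unfolding ee e2 by (simp add: Suc algebra_simps)
  also have "Q = para_opuc M \<beta> z n"
    by (simp add: Q_def para_opuc_def Suc f_def g_def)
  finally show ?thesis by (simp add: e_def)
qed

text \<open>Multiplying the preceding identity by \<open>cis \<beta>\<close> and subtracting Q_(n+1)
  eliminates the reversed polynomial.\<close>

lemma opuc_conv_para_opuc:
  assumes z: "cmod z = 1" and "0 < M" "n \<le> M"
  shows "(cis \<beta> ^ 2 - z) * poly (opuc (linear_verblunsky M \<beta>) n) z =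
    of_real (2 * cos \<beta> / real M) * cis \<beta> * (of_nat M - of_nat n) * para_opuc M \<beta> z n -
    para_opuc M \<beta> z (Suc n)"
proof -
  let ?f = "poly (opuc (linear_verblunsky M \<beta>) n) z"
  let ?g = "poly (opuc_star (linear_verblunsky M \<beta>) n) z"
  have "cis \<beta> * cnj (cis \<beta>) = 1"
    by (simp add: cis_mult cis_cnj)
  then have "cis \<beta> * (cis \<beta> * ?f + cnj (cis \<beta>) * ?g) = cis \<beta> ^ 2 * ?f + ?g"
    by (simp add: distrib_left power2_eq_square flip: mult.assoc)
  with para_opuc_conv_opuc[OF assms] show ?thesis
    by (simp add: para_opuc_def algebra_simps)
qed

text \<open>After both Szego recurrences are inserted, the constant -1 in a_n produces (z + 1)
  Q_(n+1) and the linear part produces the combination of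
  \<open>para_opuc_conv_opuc\<close>.\<close>

lemma para_opuc_rec:
  assumes z: "cmod z = 1" and "n < M"
  shows "para_opuc M \<beta> z (Suc (Suc n)) = (z + 1) * para_opuc M \<beta> z (Suc n) -
    of_nat (Suc n) * (of_nat M - of_nat n) * of_real (2 * cos \<beta> / real M) ^ 2 * z * para_opuc M \<beta> z n"
proof -
  let ?f = "poly (opuc (linear_verblunsky M \<beta>) n) z"
  let ?g = "poly (opuc_star (linear_verblunsky M \<beta>) n) z"
  let ?\<mu> = "complex_of_real (2 * cos \<beta> / real M)"
  have "para_opuc M \<beta> z (Suc (Suc n)) = (z + 1) * para_opuc M \<beta> z (Suc n) -
      ?\<mu> * of_nat (Suc n) * z * (cis \<beta> * ?f + cnj (cis \<beta>) * ?g)"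
    unfolding para_opuc_def nat.case poly_opuc_Suc poly_opuc_star_Suc[OF z] linear_verblunsky_def
    by (simp add: algebra_simps)
  also have "cis \<beta> * ?f + cnj (cis \<beta>) * ?g = ?\<mu> * (of_nat M - of_nat n) * para_opuc M \<beta> z n"
    using assms by (intro para_opuc_conv_opuc) auto
  finally show ?thesis
    by (simp only: power2_eq_square mult_ac)
qed

text \<open>For z = \<zeta>^2 the factor z + 1 is 2 \<zeta> cos \<phi> = \<mu> (2s - M) \<zeta>, so
  the rescaled recurrence is that of the Krawtchouk polynomials. The range includes n = M + 1, where
  the value is 0.\<close>

lemma para_opuc_conv_krawtchouk:
  assumes "s \<le> M" "n \<le> Suc M"
    and \<phi>: "cos \<phi> = (2 * real s / real M - 1) * cos \<beta>" and "0 < M"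
  defines "\<mu> \<equiv> 2 * cos \<beta> / real M"
  shows "para_opuc M \<beta> (cis \<phi> ^ 2) n = cis \<phi> ^ n * of_real (\<mu> ^ n * fact n * krawtchouk M n s)"
proof -
  let ?q = "para_opuc M \<beta> (cis \<phi> ^ 2)"
  let ?p = "\<lambda>n. cis \<phi> ^ n * of_real (\<mu> ^ n * fact n * krawtchouk M n s)"
  have "2 * cos \<phi> = \<mu> * (2 * real s - real M)"
    using \<open>0 < M\<close> by (simp add: \<phi> \<mu>_def field_simps)
  moreover have "cis \<phi> ^ 2 + 1 = cis \<phi> * of_real (2 * cos \<phi>)"
    by (simp add: complex_eq_iff power2_eq_square) (simp add: cos_squared_eq algebra_simps flip: power2_eq_square)
  ultimately have z1: "cis \<phi> ^ 2 + 1 = cis \<phi> * of_real (\<mu> * (2 * real s - real M))"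
    by simp
  have unit: "cmod (cis \<phi> ^ 2) = 1"
    by (simp add: norm_power)
  have "(n \<le> M \<longrightarrow> ?q n = ?p n) \<and> (n \<le> M \<longrightarrow> ?q (Suc n) = ?p (Suc n))" for n
  proof (induction n)
    case 0
    then show ?case
      using z1 \<open>s \<le> M\<close> by (simp add: para_opuc_def opuc_star_def krawtchouk_1)
  next
    case (Suc n)
    have "?q (Suc (Suc n)) = ?p (Suc (Suc n))" if n: "Suc n \<le> M"
    proof -
      have "?q (Suc (Suc n)) = cis \<phi> * of_real (\<mu> * (2 * real s - real M)) * ?p (Suc n) -
          of_nat (Suc n) * (of_nat M - of_nat n) * of_real \<mu> ^ 2 * cis \<phi> ^ 2 * ?p n"
        using Suc n
        by (subst para_opuc_rec[OF unit]) (simp_all add: z1 \<mu>_def)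
      also have "\<dots> = cis \<phi> ^ Suc (Suc n) * of_real (\<mu> ^ Suc (Suc n) * fact (Suc n) *
          ((2 * real s - real M) * krawtchouk M (n + 1) s - (real M - real n) * krawtchouk M n s))"
        by (simp add: power2_eq_square algebra_simps)
      also have "\<dots> = ?p (Suc (Suc n))"
        unfolding krawtchouk_rec[OF \<open>s \<le> M\<close>, symmetric] by (simp add: algebra_simps)
      finally show ?thesis .
    qed
    with Suc show ?case by simp
  qed
  note this[of n] this[of "n - 1"]
  then show ?thesis
    using \<open>n \<le> Suc M\<close> by (cases n) auto
qed

subsection \<open>Nodes and weights\<close>

text \<open>Half of a root angle. The index s = M, whose point is \<omega> for \<beta> in [0, pi],
  is an auxiliary one that completes the Krawtchouk grid.\<close>

definition node_angle :: "nat \<Rightarrow> real \<Rightarrow> nat \<Rightarrow> real" where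
  "node_angle M \<beta> s = arccos ((2 * real s / real M - 1) * cos \<beta>)"

lemma node_arg_abs_le:
  assumes "0 < M" "s \<le> M"
  shows "\<bar>2 * real s / real M - 1\<bar> \<le> 1"
proof -
  have "0 \<le> real s / real M" "real s / real M \<le> 1"
    using assms by (simp_all add: divide_le_eq_1)
  then show ?thesis by (simp add: abs_le_iff)
qed

lemma node_arg_bounded:
  assumes "0 < M" "s \<le> M"
  shows "\<bar>(2 * real s / real M - 1) * cos \<beta>\<bar> \<le> \<bar>cos \<beta>\<bar>"
  using mult_right_mono[OF node_arg_abs_le[OF assms], of "\<bar>cos \<beta>\<bar>"] by (simp add: abs_mult)

lemma cos_node_angle:
  assumes "0 < M" "s \<le> M"
  shows "cos (node_angle M \<beta> s) = (2 * real s / real M - 1) * cos \<beta>"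
proof -
  have "\<bar>(2 * real s / real M - 1) * cos \<beta>\<bar> \<le> 1"
    using node_arg_bounded[OF assms] abs_cos_le_one by (rule order.trans)
  then show ?thesis by (simp add: node_angle_def cos_arccos_abs)
qed

lemma node_angle_bounds:
  assumes "0 < M" "s \<le> M"
  shows "0 \<le> node_angle M \<beta> s" "node_angle M \<beta> s \<le> pi"
proof -
  have "\<bar>(2 * real s / real M - 1) * cos \<beta>\<bar> \<le> 1"
    using node_arg_bounded[OF assms] abs_cos_le_one by (rule order.trans)
  then show "0 \<le> node_angle M \<beta> s" "node_angle M \<beta> s \<le> pi"
    using arccos_bounded by (auto simp: node_angle_def abs_le_iff)
qed

lemma node_angle_reflect:
  assumes "0 < M" "s \<le> M"
  shows "node_angle M \<beta> (M - s) = pi - node_angle M \<beta> s"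
proof -
  have "\<bar>(2 * real s / real M - 1) * cos \<beta>\<bar> \<le> 1"
    using node_arg_bounded[OF assms] abs_cos_le_one by (rule order.trans)
  moreover have "(2 * real (M - s) / real M - 1) * cos \<beta> = - ((2 * real s / real M - 1) * cos \<beta>)"
    using assms by (simp add: of_nat_diff field_simps)
  ultimately show ?thesis
    by (simp only: node_angle_def) (subst arccos_minus, auto simp: abs_le_iff)
qed

lemma node_angle_last:
  assumes "0 < M" "0 \<le> \<beta>" "\<beta> \<le> pi"
  shows "node_angle M \<beta> M = \<beta>"
  using assms by (simp add: node_angle_def arccos_cos)

text \<open>The argument of the arccosine is strictly inside (-1, 1) either because the index is
  interior or because |cos \<beta>| < 1. An end index with \<beta> = 0 has angle 0 or pi
  instead.\<close>

lemma sin_node_angle_pos: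
  assumes "0 < M" "s \<le> M" "s \<noteq> 0 \<and> s \<noteq> M \<or> (0 < \<beta> \<and> \<beta> < pi)"
  shows "0 < sin (node_angle M \<beta> s)"
proof -
  have "\<bar>(2 * real s / real M - 1) * cos \<beta>\<bar> < 1"
  proof (cases "0 < \<beta> \<and> \<beta> < pi")
    case True
    then have "0 < sin \<beta>" by (simp add: sin_gt_zero)
    then have "0 < (sin \<beta>)\<^sup>2" by simp
    then have "(cos \<beta>)\<^sup>2 < 1"
      using sin_cos_squared_add[of \<beta>] by linarith
    then have "\<bar>cos \<beta>\<bar> < 1" by (simp add: abs_square_less_1)
    then show ?thesis using node_arg_bounded[OF assms(1,2), of \<beta>] by linarith
  next
    case False
    then have "\<bar>2 * real s / real M - 1\<bar> < 1"
      using assms by (auto simp: abs_less_iff field_simps)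
    moreover have "\<bar>(2 * real s / real M - 1) * cos \<beta>\<bar> \<le> \<bar>2 * real s / real M - 1\<bar>"
      using mult_left_mono[OF abs_cos_le_one, of "\<bar>2 * real s / real M - 1\<bar>" \<beta>]
      by (simp add: abs_mult)
    ultimately show ?thesis by linarith
  qed
  then show ?thesis
    using arccos_lt_bounded by (intro sin_gt_zero) (auto simp: node_angle_def abs_less_iff)
qed

text \<open>The cosine at the node is cos \<beta> times a factor below 1, so all nodes lie on one
  side of \<beta>. The absolute value in the weights thus amounts to a sign independent of
  s.\<close>

lemma sin_node_angle_diff_pos:
  assumes "s < M" "0 \<le> \<beta>" "\<beta> < pi" "cos \<beta> \<noteq> 0" "0 < \<beta> \<or> s \<noteq> 0"
  shows "0 < sgn (cos \<beta>) * sin (node_angle M \<beta> s - \<beta>)"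
proof -
  let ?\<phi> = "node_angle M \<beta> s"
  have M: "0 < M" "s \<le> M" using assms by auto
  have \<phi>: "0 \<le> ?\<phi>" "?\<phi> \<le> pi" using node_angle_bounds[OF M] by auto
  have x: "2 * real s / real M - 1 < 1"
    using assms(1) by (simp add: field_simps)
  consider "0 < cos \<beta>" | "cos \<beta> < 0" using assms by linarith
  then show ?thesis
  proof cases
    case 1
    then have "cos ?\<phi> < cos \<beta>"
      using x by (simp add: cos_node_angle[OF M])
    then have "\<beta> < ?\<phi>"
      using \<phi> assms cos_monotone_0_pi_le[of ?\<phi> \<beta>] by linarith
    moreover have "?\<phi> - \<beta> < pi"
    proof (cases "\<beta> = 0")
      case True
      then have "0 < sin ?\<phi>"
        using assms M by (intro sin_node_angle_pos) auto
      then have "?\<phi> \<noteq> pi" by auto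
      with \<phi> True show ?thesis by simp
    qed (use \<phi> assms in auto)
    ultimately show ?thesis using 1 by (simp add: sin_gt_zero)
  next
    case 2
    then have "cos \<beta> < cos ?\<phi>"
      using x by (simp add: cos_node_angle[OF M])
    then have "?\<phi> < \<beta>"
      using \<phi> assms cos_monotone_0_pi_le[of \<beta> ?\<phi>] by linarith
    then have "0 < sin (\<beta> - ?\<phi>)"
      using \<phi> assms by (intro sin_gt_zero) auto
    moreover have "sin (?\<phi> - \<beta>) = - sin (\<beta> - ?\<phi>)"
      by (metis minus_diff_eq sin_minus)
    ultimately show ?thesis using 2 by simp
  qed
qed

text \<open>In [0, pi] only the pair 0, pi gives the same point after doubling; the last assumption
  excludes it.\<close>

lemma cis_double_eq_iff:
  assumes "0 \<le> x" "x \<le> pi" "0 \<le> y" "y \<le> pi" "\<bar>x - y\<bar> \<noteq> pi"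
  shows "cis (2 * x) = cis (2 * y) \<longleftrightarrow> x = y"
proof
  assume "cis (2 * x) = cis (2 * y)"
  then have "cis (2 * x) / cis (2 * y) = 1" by simp
  then have "cos (2 * (x - y)) = 1"
    by (simp add: cis_divide complex_eq_iff right_diff_distrib)
  then have "1 - 2 * (sin (x - y))\<^sup>2 = 1"
    by (simp only: cos_double_sin)
  then have "sin (x - y) = 0" by simp
  then have "sin \<bar>x - y\<bar> = 0"
    by (metis abs_if minus_equation_iff neg_0_equal_iff_equal sin_minus)
  moreover have "\<bar>x - y\<bar> < pi" using assms by auto
  ultimately show "x = y"
    using sin_gt_zero[of "\<bar>x - y\<bar>"] by (cases "x = y") auto
qed simp

lemma cis_double_diff: "cis (2 * x) - cis (2 * y) = 2 * \<i> * cis x * cis y * of_real (sin (x - y))"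
proof -
  have diff: "cis t - cis (- t) = 2 * \<i> * of_real (sin t)" for t
    by (simp add: complex_eq_iff)
  have "cis (2 * x) = cis (x + y) * cis (x - y)" "cis (2 * y) = cis (x + y) * cis (- (x - y))"
    by (simp_all add: cis_mult)
  then have "cis (2 * x) - cis (2 * y) = cis (x + y) * (cis (x - y) - cis (- (x - y)))"
    by (simp only: right_diff_distrib)
  also have "cis (x - y) - cis (- (x - y)) = 2 * \<i> * of_real (sin (x - y))"
    unfolding diff by simp
  finally show ?thesis by (simp add: cis_mult[of x y, symmetric])
qed

text \<open>The index M is left out since for \<beta> = 0 it shares the point 1 with s = 0. Of two
  distinct indices below M one is positive and has its angle strictly between 0 and pi, so the pair
  0, pi cannot occur.\<close>

lemma inj_on_node_points:
  assumes "0 \<le> \<beta>" "\<beta> < pi" "cos \<beta> \<noteq> 0"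
  shows "inj_on (\<lambda>s. cis (2 * node_angle M \<beta> s)) {..<M}"
proof (rule inj_onI)
  fix s r assume sr: "s \<in> {..<M}" "r \<in> {..<M}"
    and eq: "cis (2 * node_angle M \<beta> s) = cis (2 * node_angle M \<beta> r)"
  then have M: "0 < M" "s \<le> M" "r \<le> M" by auto
  have lt: "node_angle M \<beta> t < pi \<and> 0 < node_angle M \<beta> t" if "0 < t" "t < M" for t
  proof -
    have "0 < sin (node_angle M \<beta> t)"
      using that by (intro sin_node_angle_pos) auto
    then have "node_angle M \<beta> t \<noteq> 0" "node_angle M \<beta> t \<noteq> pi" by auto
    moreover have "0 \<le> node_angle M \<beta> t" "node_angle M \<beta> t \<le> pi"
      using that node_angle_bounds[of M t] by auto
    ultimately show ?thesis by linarith
  qed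
  have "\<bar>node_angle M \<beta> s - node_angle M \<beta> r\<bar> \<noteq> pi"
  proof (cases "s = r")
    case False
    then consider "0 < s" | "0 < r" by linarith
    then show ?thesis
      using lt[of s] lt[of r] sr node_angle_bounds[of M s \<beta>] node_angle_bounds[of M r \<beta>] M
      by cases (simp_all, linarith+)
  qed simp
  then have "node_angle M \<beta> s = node_angle M \<beta> r"
    using eq node_angle_bounds M by (subst (asm) cis_double_eq_iff) auto
  then have "cos (node_angle M \<beta> s) = cos (node_angle M \<beta> r)" by simp
  then show "s = r"
    using M assms(3) by (simp add: cos_node_angle)
qed

text \<open>For \<open>\<beta> = 0\<close> the node with \<open>s = 0\<close> is \<open>z = 1 = \<omega>\<close>, where the quotient is \<open>0/0\<close>; the value
  is its limit, \<open>sin (2 * \<beta>) / sin \<beta> \<longlonglongrightarrow> 2\<close>.\<close>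

definition node_weight :: "nat \<Rightarrow> real \<Rightarrow> nat \<Rightarrow> real" where
  "node_weight M \<beta> s = 1 / (fact s * fact (M - s)) *
     (if \<beta> = 0 \<and> s = 0 then 2 else \<bar>sin (node_angle M \<beta> s - \<beta>) / sin (node_angle M \<beta> s)\<bar>)"

lemma node_weight_pos:
  assumes "s < M" "0 \<le> \<beta>" "\<beta> < pi" "cos \<beta> \<noteq> 0"
  shows "0 < node_weight M \<beta> s"
proof (cases "\<beta> = 0 \<and> s = 0")
  case False
  then have "0 < sgn (cos \<beta>) * sin (node_angle M \<beta> s - \<beta>)" "0 < sin (node_angle M \<beta> s)"
    using assms by (auto intro!: sin_node_angle_diff_pos sin_node_angle_pos)
  then have "0 < \<bar>sin (node_angle M \<beta> s - \<beta>) / sin (node_angle M \<beta> s)\<bar>"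
    by (subst zero_less_abs_iff) (metis divide_eq_0_iff less_irrefl mult_zero_right)
  then have "0 < 1 / (fact s * fact (M - s)) *
      \<bar>sin (node_angle M \<beta> s - \<beta>) / sin (node_angle M \<beta> s)\<bar>"
    by (rule mult_pos_pos[rotated]) simp
  then show ?thesis using False by (simp only: node_weight_def if_False)
qed (simp add: node_weight_def)

text \<open>At n = M both the factor M - n and the Krawtchouk value of degree M + 1 vanish, and
  \<omega> - z_s can be cancelled since \<beta> > 0.\<close>

lemma opuc_node_eq_0_generic:
  assumes "0 < \<beta>" "\<beta> < pi" "cos \<beta> \<noteq> 0" "s < M"
  shows "poly (opuc (linear_verblunsky M \<beta>) M) (cis (2 * node_angle M \<beta> s)) = 0"
proof -
  let ?\<phi> = "node_angle M \<beta> s"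
  let ?f = "poly (opuc (linear_verblunsky M \<beta>) M) (cis (2 * ?\<phi>))"
  have "(cis \<beta> ^ 2 - cis ?\<phi> ^ 2) * poly (opuc (linear_verblunsky M \<beta>) M) (cis ?\<phi> ^ 2) = 0"
    using opuc_conv_para_opuc[of "cis ?\<phi> ^ 2" M M \<beta>] assms
      para_opuc_conv_krawtchouk[of s M "Suc M" ?\<phi> \<beta>] cos_node_angle[of M s \<beta>]
    by (simp add: norm_power krawtchouk_eq_0)
  moreover have "cis ?\<phi> ^ 2 = cis (2 * ?\<phi>)" "cis \<beta> ^ 2 = cis (2 * \<beta>)"
    by (simp_all add: Complex.DeMoivre)
  ultimately have "(cis (2 * ?\<phi>) - cis (2 * \<beta>)) * ?f = 0"
    by (simp only: mult_eq_0_iff right_minus_eq eq_commute[of "cis (2 * \<beta>)"])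
  moreover have "sin (?\<phi> - \<beta>) \<noteq> 0"
    using sin_node_angle_diff_pos[of s M \<beta>] assms by auto
  ultimately show ?thesis
    by (simp add: cis_double_diff)
qed

text \<open>The factor \<omega> - z_s contains one \<zeta>, which cancels: degree n meets
  \<zeta>^(n-1) and degree n + 1 meets \<zeta>^n. Both pairs satisfy the conditions of
  \<open>krawtchouk_sum_cis\<close>.\<close>

lemma sum_opuc_nodes_eq_0_generic:
  assumes "0 < \<beta>" "\<beta> < pi" "cos \<beta> \<noteq> 0" "0 < n" "n < M"
  shows "(\<Sum>s<M. of_real (node_weight M \<beta> s) *
            poly (opuc (linear_verblunsky M \<beta>) n) (cis (2 * node_angle M \<beta> s))) = 0"
proof -
  define \<phi> where "\<phi> = node_angle M \<beta>"
  define \<mu> where "\<mu> = 2 * cos \<beta> / real M"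
  define f where "f s = poly (opuc (linear_verblunsky M \<beta>) n) (cis (2 * \<phi> s))" for s
  define C where "C s = complex_of_nat (M choose s)" for s
  obtain k where k: "n = Suc k" using \<open>0 < n\<close> by (cases n) auto
  have M: "0 < M" using assms by simp
  have cos: "cos (\<phi> s) = (2 * real s / real M - 1) * cos \<beta>" if "s \<le> M" for s
    using that M by (simp add: \<phi>_def cos_node_angle)
  have cos': "2 * cos (\<phi> s) = \<mu> * (2 * real s - real M)" if "s \<le> M" for s
    using M by (simp add: cos[OF that] \<mu>_def field_simps)
  have sin: "sin (\<phi> s) \<noteq> 0" if "s \<le> M" for s
    using sin_node_angle_pos[of M s \<beta>] that assms by (simp add: \<phi>_def)
  have refl: "\<phi> (M - s) = pi - \<phi> s" if "s \<le> M" for s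
    using that M by (simp add: \<phi>_def node_angle_reflect)
  define T where "T m j s = C s * of_real (krawtchouk M m s) * (cis (\<phi> s) ^ j / of_real (sin (\<phi> s)))" for m j s
  have sum_T: "(\<Sum>s\<le>M. T m j s) = 0" if "j \<le> m" "odd (m + j)" for m j
    unfolding T_def C_def by (rule krawtchouk_sum_cis[of M \<phi> \<mu>, OF cos' sin refl that])
  have T: "(\<Sum>s\<le>M. T n k s) = 0" "(\<Sum>s\<le>M. T (Suc n) n s) = 0"
    using k by (simp_all add: sum_T)
  define c1 where "c1 = of_real (\<mu> ^ Suc n * fact n) * cis \<beta> * (of_nat M - of_nat n)"
  define c2 where "c2 = complex_of_real (\<mu> ^ Suc n * fact (Suc n))"
  \<comment> \<open>The scalar is the inverse of \<open>- 2 * \<i> * cis \<beta>\<close>, the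
    constant in \<omega> - z_s.\<close>
  have summand: "C s * of_real (sin (\<phi> s - \<beta>) / sin (\<phi> s)) * f s =
      \<i> / (2 * cis \<beta>) * (c1 * T n k s - c2 * T (Suc n) n s)" if s: "s \<le> M" for s
  proof -
    have z: "cis (2 * \<phi> s) = cis (\<phi> s) ^ 2" "cis (2 * \<beta>) = cis \<beta> ^ 2"
      by (simp_all add: Complex.DeMoivre)
    have "(cis \<beta> ^ 2 - cis (\<phi> s) ^ 2) * f s = of_real \<mu> * cis \<beta> * (of_nat M - of_nat n) *
        (cis (\<phi> s) ^ n * of_real (\<mu> ^ n * fact n * krawtchouk M n s)) -
        cis (\<phi> s) ^ Suc n * of_real (\<mu> ^ Suc n * fact (Suc n) * krawtchouk M (Suc n) s)"
      using opuc_conv_para_opuc[of "cis (\<phi> s) ^ 2" M n \<beta>] assms M s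
        para_opuc_conv_krawtchouk[of s M n "\<phi> s" \<beta>] para_opuc_conv_krawtchouk[of s M "Suc n" "\<phi> s" \<beta>] cos[OF s]
      by (simp add: norm_power f_def z \<mu>_def del: power_Suc fact_Suc of_real_mult of_real_divide)
    also have "\<dots> = cis (\<phi> s) * (c1 * (of_real (krawtchouk M n s) * cis (\<phi> s) ^ k) -
        c2 * (of_real (krawtchouk M (Suc n) s) * cis (\<phi> s) ^ n))"
      by (simp add: c1_def c2_def k algebra_simps)
    finally have "(cis (2 * \<beta>) - cis (2 * \<phi> s)) * f s = \<dots>"
      by (simp only: z)
    moreover have "cis (2 * \<beta>) - cis (2 * \<phi> s) = - 2 * \<i> * cis (\<phi> s) * cis \<beta> * of_real (sin (\<phi> s - \<beta>))"
      using cis_double_diff[of "\<phi> s" \<beta>] by (simp add: algebra_simps)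
    ultimately have "cis (\<phi> s) * (- 2 * \<i> * cis \<beta> * of_real (sin (\<phi> s - \<beta>)) * f s) =
        cis (\<phi> s) * (c1 * (of_real (krawtchouk M n s) * cis (\<phi> s) ^ k) -
        c2 * (of_real (krawtchouk M (Suc n) s) * cis (\<phi> s) ^ n))"
      by (simp add: mult_ac)
    then have "- 2 * \<i> * cis \<beta> * of_real (sin (\<phi> s - \<beta>)) * f s =
        c1 * (of_real (krawtchouk M n s) * cis (\<phi> s) ^ k) -
        c2 * (of_real (krawtchouk M (Suc n) s) * cis (\<phi> s) ^ n)"
      by (simp only: mult_cancel_left cis_neq_zero simp_thms)
    then have "C s / of_real (sin (\<phi> s)) * (\<i> / (2 * cis \<beta>)) *
          (- 2 * \<i> * cis \<beta> * of_real (sin (\<phi> s - \<beta>)) * f s) =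
        C s / of_real (sin (\<phi> s)) * (\<i> / (2 * cis \<beta>)) *
          (c1 * (of_real (krawtchouk M n s) * cis (\<phi> s) ^ k) -
           c2 * (of_real (krawtchouk M (Suc n) s) * cis (\<phi> s) ^ n))"
      by (rule arg_cong)
    then show ?thesis
      by (simp add: T_def mult_ac) (simp add: algebra_simps diff_divide_distrib)
  qed
  \<comment> \<open>The weight factor vanishes at the auxiliary index, so the sum over the roots
    extends to the whole grid.\<close>
  have last: "sin (\<phi> M - \<beta>) = 0"
    using assms by (simp add: \<phi>_def node_angle_last)
  have weight: "complex_of_real (node_weight M \<beta> s) =
      of_real (sgn (cos \<beta>) / fact M) * (C s * of_real (sin (\<phi> s - \<beta>) / sin (\<phi> s)))"
    if "s < M" for s
  proof -
    have "0 < sin (\<phi> s)" "0 < sgn (cos \<beta>) * sin (\<phi> s - \<beta>)"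
      using sin_node_angle_pos[of M s \<beta>] sin_node_angle_diff_pos[of s M \<beta>] that assms
      by (simp_all add: \<phi>_def)
    then have "\<bar>sin (\<phi> s - \<beta>) / sin (\<phi> s)\<bar> = sgn (cos \<beta>) * (sin (\<phi> s - \<beta>) / sin (\<phi> s))"
      by (auto simp: sgn_if abs_if zero_less_mult_iff divide_simps split: if_splits)
    then have "node_weight M \<beta> s =
        sgn (cos \<beta>) / fact M * (real (M choose s) * (sin (\<phi> s - \<beta>) / sin (\<phi> s)))"
      using that assms(1) by (simp add: node_weight_def \<phi>_def binomial_fact)
    then show ?thesis by (simp add: C_def)
  qed
  have "(\<Sum>s<M. of_real (node_weight M \<beta> s) * f s) = of_real (sgn (cos \<beta>) / fact M) *
      (\<Sum>s<M. C s * of_real (sin (\<phi> s - \<beta>) / sin (\<phi> s)) * f s)"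
    unfolding sum_distrib_left by (intro sum.cong) (auto simp: weight)
  also have "(\<Sum>s<M. C s * of_real (sin (\<phi> s - \<beta>) / sin (\<phi> s)) * f s) =
      (\<Sum>s\<le>M. C s * of_real (sin (\<phi> s - \<beta>) / sin (\<phi> s)) * f s)"
    by (simp add: last lessThan_Suc_atMost[symmetric])
  also have "\<dots> = (\<Sum>s\<le>M. \<i> / (2 * cis \<beta>) * (c1 * T n k s - c2 * T (Suc n) n s))"
    by (intro sum.cong summand) auto
  also have "\<dots> = \<i> / (2 * cis \<beta>) * (c1 * (\<Sum>s\<le>M. T n k s) - c2 * (\<Sum>s\<le>M. T (Suc n) n s))"
    by (simp only: sum_distrib_left right_diff_distrib sum_subtractf)
  finally show ?thesis
    unfolding T by (simp add: f_def \<phi>_def)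
qed

section \<open>The limit \<beta> -> 0 from the right\<close>

lemma tendsto_node_angle:
  assumes "0 < M" "s \<le> M"
  shows "((\<lambda>\<beta>. node_angle M \<beta> s) \<longlongrightarrow> node_angle M \<beta>\<^sub>0 s) (at \<beta>\<^sub>0 within S)"
proof -
  have "(2 * real s / real M - 1) * cos \<beta> \<in> {-1..1}" for \<beta>
    using order.trans[OF node_arg_bounded[OF assms] abs_cos_le_one] by (auto simp: abs_le_iff)
  moreover have "((\<lambda>\<beta>. (2 * real s / real M - 1) * cos \<beta>) \<longlongrightarrow> (2 * real s / real M - 1) * cos \<beta>\<^sub>0) (at \<beta>\<^sub>0 within S)"
    by (intro tendsto_intros)
  ultimately show ?thesis
    unfolding node_angle_def by (intro continuous_on_tendsto_compose[OF continuous_on_arccos']) auto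
qed

text \<open>For s = 0 the angle is pi - \<beta> and the quotient is sin(2 \<beta>) / sin \<beta> = 2
  cos \<beta>. For s > 0 the denominator stays nonzero in the limit.\<close>

lemma tendsto_node_weight:
  assumes "s < M"
  shows "((\<lambda>\<beta>. node_weight M \<beta> s) \<longlongrightarrow> node_weight M 0 s) (at_right 0)"
proof -
  have ev: "eventually (\<lambda>\<beta>. \<beta> \<in> {0<..<pi}) (at_right (0::real))"
    by (rule eventually_at_right_real) simp
  have M: "0 < M" "s \<le> M" using assms by auto
  show ?thesis
  proof (cases "s = 0")
    case True
    have "((\<lambda>\<beta>. 1 / fact M * \<bar>2 * cos \<beta>\<bar>) \<longlongrightarrow> 1 / fact M * \<bar>2 * cos (0::real)\<bar>) (at_right 0)"
      by (intro tendsto_intros)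
    moreover have "eventually (\<lambda>\<beta>. 1 / fact M * \<bar>2 * cos \<beta>\<bar> = node_weight M \<beta> s) (at_right 0)"
      using ev
    proof eventually_elim
      case (elim \<beta>)
      have "node_angle M \<beta> 0 = pi - \<beta>"
        using node_angle_reflect[of M M \<beta>] node_angle_last[of M \<beta>] elim M by simp
      moreover have "sin (pi - \<beta> - \<beta>) = sin (2 * \<beta>)"
        by (metis diff_diff_eq mult_2 sin_pi_minus)
      moreover have "sin \<beta> \<noteq> 0"
        using sin_gt_zero[of \<beta>] elim by auto
      ultimately show ?case
        using True elim by (simp add: node_weight_def sin_double)
    qed
    ultimately have "((\<lambda>\<beta>. node_weight M \<beta> s) \<longlongrightarrow> 1 / fact M * \<bar>2 * cos (0::real)\<bar>) (at_right 0)"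
      by (rule Lim_transform_eventually)
    then show ?thesis
      using True by (simp add: node_weight_def[of M 0])
  next
    case False
    have "((\<lambda>\<beta>. node_angle M \<beta> s) \<longlongrightarrow> node_angle M 0 s) (at_right 0)"
      by (rule tendsto_node_angle[OF M])
    moreover have "sin (node_angle M 0 s) \<noteq> 0"
      using sin_node_angle_pos[of M s 0] False assms by simp
    ultimately have "((\<lambda>\<beta>. 1 / (fact s * fact (M - s)) *
          \<bar>sin (node_angle M \<beta> s - \<beta>) / sin (node_angle M \<beta> s)\<bar>) \<longlongrightarrow>
        1 / (fact s * fact (M - s)) * \<bar>sin (node_angle M 0 s - 0) / sin (node_angle M 0 s)\<bar>) (at_right 0)"
      by (intro tendsto_intros)
    then show ?thesis
      using False by (simp only: node_weight_def simp_thms if_False)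
  qed
qed

lemma tendsto_poly_opuc_node:
  assumes "s < M"
  shows "((\<lambda>\<beta>. poly (opuc (linear_verblunsky M \<beta>) n) (cis (2 * node_angle M \<beta> s)))
           \<longlongrightarrow> poly (opuc (linear_verblunsky M 0) n) (cis (2 * node_angle M 0 s))) (at_right 0)"
proof (rule tendsto_poly_opuc)
  have "((\<lambda>\<beta>. node_angle M \<beta> s) \<longlongrightarrow> node_angle M 0 s) (at_right 0)"
    using assms by (intro tendsto_node_angle) auto
  then show "((\<lambda>\<beta>. 2 * node_angle M \<beta> s) \<longlongrightarrow> 2 * node_angle M 0 s) (at_right 0)"
    by (intro tendsto_intros)
  show "((\<lambda>\<beta>. linear_verblunsky M \<beta> k) \<longlongrightarrow> linear_verblunsky M 0 k) (at_right 0)" for k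
    unfolding linear_verblunsky_def cis_conv_exp using assms by (intro tendsto_intros) auto
qed

lemma eventually_generic_at_right_0:
  "eventually (\<lambda>\<beta>. 0 < \<beta> \<and> \<beta> < pi \<and> cos \<beta> \<noteq> 0) (at_right (0::real))"
proof -
  have "eventually (\<lambda>\<beta>. \<beta> \<in> {0<..<pi / 2}) (at_right (0::real))"
    by (rule eventually_at_right_real) simp
  then show ?thesis
  proof eventually_elim
    case (elim \<beta>)
    then show ?case using cos_gt_zero[of \<beta>] by auto
  qed
qed

text \<open>At \<beta> = 0 the node s = 0 coincides with \<omega> and nothing can be cancelled;
  continuity in \<beta> replaces the cancellation.\<close>

lemma opuc_node_eq_0:
  assumes "0 \<le> \<beta>" "\<beta> < pi" "cos \<beta> \<noteq> 0" "s < M"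
  shows "poly (opuc (linear_verblunsky M \<beta>) M) (cis (2 * node_angle M \<beta> s)) = 0"
proof (cases "\<beta> = 0")
  case True
  have "eventually (\<lambda>\<beta>. poly (opuc (linear_verblunsky M \<beta>) M) (cis (2 * node_angle M \<beta> s)) = 0) (at_right 0)"
    using eventually_generic_at_right_0 by eventually_elim (simp add: opuc_node_eq_0_generic assms)
  then show ?thesis
    unfolding True
    by (intro tendsto_unique[OF _ tendsto_poly_opuc_node tendsto_eventually] assms) auto
qed (use assms opuc_node_eq_0_generic in auto)

lemma sum_opuc_nodes_eq_0:
  assumes "0 \<le> \<beta>" "\<beta> < pi" "cos \<beta> \<noteq> 0" "0 < n" "n < M"
  shows "(\<Sum>s<M. of_real (node_weight M \<beta> s) *
            poly (opuc (linear_verblunsky M \<beta>) n) (cis (2 * node_angle M \<beta> s))) = 0"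
    (is "?S \<beta> = 0")
proof (cases "\<beta> = 0")
  case True
  have "eventually (\<lambda>\<beta>. ?S \<beta> = 0) (at_right 0)"
    using eventually_generic_at_right_0 by eventually_elim (simp add: sum_opuc_nodes_eq_0_generic assms)
  moreover have "(?S \<longlongrightarrow> ?S 0) (at_right 0)"
    by (intro tendsto_intros tendsto_poly_opuc_node tendsto_node_weight) auto
  ultimately show ?thesis
    unfolding True by (intro tendsto_unique[OF _ _ tendsto_eventually]) auto
qed (use assms sum_opuc_nodes_eq_0_generic in auto)

subsection \<open>Angles in an arbitrary period\<close>

lemma cos_add_int_pi: "cos (x + of_int k * pi) = (if even k then cos x else - cos x)"
  by (simp add: cos_add mult.commute[of _ pi])

lemma sin_add_int_pi: "sin (x + of_int k * pi) = (if even k then sin x else - sin x)"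
  by (simp add: sin_add mult.commute[of _ pi])

text \<open>Subtracting k pi from both half-angles multiplies both cosines by (-1)^k. The equation
  is preserved and its unknown falls in [0, pi], where the cosine is injective.\<close>

lemma root_angle_eq_iff:
  fixes \<sigma> :: real and N :: nat
  defines "k \<equiv> \<lfloor>\<sigma> / (2 * pi)\<rfloor>"
  defines "\<beta> \<equiv> \<sigma> / 2 - of_int k * pi"
  assumes "s \<le> N"
  shows "root_angle_eq N \<sigma> s t \<longleftrightarrow> t = 2 * (node_angle (N + 1) \<beta> s + of_int k * pi)"
proof -
  define u where "u = t / 2 - of_int k * pi"
  have t: "t / 2 = u + of_int k * pi" and \<sigma>: "\<sigma> / 2 = \<beta> + of_int k * pi"
    by (simp_all add: u_def \<beta>_def)
  define x where "x = 2 * real s / (real N + 1) - 1"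
  have node: "node_angle (N + 1) \<beta> s = arccos (x * cos \<beta>)"
    by (simp add: node_angle_def x_def add.commute)
  have cos_node: "cos (node_angle (N + 1) \<beta> s) = x * cos \<beta>"
    using cos_node_angle[of "N + 1" s \<beta>] \<open>s \<le> N\<close> by (simp add: x_def add.commute)
  have bounds: "0 \<le> node_angle (N + 1) \<beta> s" "node_angle (N + 1) \<beta> s \<le> pi"
    using node_angle_bounds[of "N + 1" s \<beta>] \<open>s \<le> N\<close> by auto
  have "root_angle_eq N \<sigma> s t \<longleftrightarrow> 0 \<le> u \<and> u \<le> pi \<and> cos (t / 2) = x * cos (\<sigma> / 2)"
    unfolding root_angle_eq_def k_def[symmetric] u_def x_def by (auto simp: algebra_simps)
  also have "\<dots> \<longleftrightarrow> 0 \<le> u \<and> u \<le> pi \<and> cos u = x * cos \<beta>"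
    unfolding t \<sigma> cos_add_int_pi by auto
  also have "\<dots> \<longleftrightarrow> u = node_angle (N + 1) \<beta> s"
    using bounds cos_node node by (metis arccos_cos)
  also have "\<dots> \<longleftrightarrow> t = 2 * (node_angle (N + 1) \<beta> s + of_int k * pi)"
    by (auto simp: u_def field_simps)
  finally show ?thesis .
qed

lemma root_angle_eq_node_angle:
  fixes \<sigma> :: real and N :: nat
  assumes "s \<le> N"
  shows "root_angle N \<sigma> s = 2 * (node_angle (N + 1) (\<sigma> / 2 - of_int \<lfloor>\<sigma> / (2 * pi)\<rfloor> * pi) s +
    of_int \<lfloor>\<sigma> / (2 * pi)\<rfloor> * pi)"
  unfolding root_angle_def root_angle_eq_iff[OF assms] by simp

lemma exp_double_add_int_pi: "exp (\<i> * of_real (2 * (x + of_int k * pi))) = cis (2 * x)"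
proof -
  have "exp (\<i> * of_real (2 * (x + of_int k * pi))) = cis (2 * x + 2 * pi * of_int k)"
    by (simp add: cis_conv_exp algebra_simps)
  also have "\<dots> = cis (2 * x) * cis (2 * pi * of_int k)"
    by (simp only: cis_mult)
  also have "cis (2 * pi * of_int k) = 1"
    by (simp add: cis_multiple_2pi)
  finally show ?thesis by simp
qed

lemma half_angle_bounds:
  fixes \<sigma> :: real
  shows "0 \<le> \<sigma> / 2 - of_int \<lfloor>\<sigma> / (2 * pi)\<rfloor> * pi" "\<sigma> / 2 - of_int \<lfloor>\<sigma> / (2 * pi)\<rfloor> * pi < pi"
proof -
  define k where "k = \<lfloor>\<sigma> / (2 * pi)\<rfloor>"
  have "of_int k \<le> \<sigma> / (2 * pi)" "\<sigma> / (2 * pi) < of_int k + 1"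
    unfolding k_def by linarith+
  then show "0 \<le> \<sigma> / 2 - of_int \<lfloor>\<sigma> / (2 * pi)\<rfloor> * pi" "\<sigma> / 2 - of_int \<lfloor>\<sigma> / (2 * pi)\<rfloor> * pi < pi"
    unfolding k_def[symmetric] by (simp_all add: field_simps)
qed

text \<open>A chord is twice the sine of the half-angle difference in modulus. Zero denominators
  occur on both sides together, with value 0.\<close>

lemma weight_exp_eq_weight_sin: "weight_exp N \<sigma> s = weight_sin N \<sigma> s"
proof -
  let ?x = "root_angle N \<sigma> s / 2"
  have "exp (\<i> * of_real (root_angle N \<sigma> s)) = cis (2 * ?x)"
    "exp (\<i> * of_real \<sigma>) = cis (2 * (\<sigma> / 2))" "1 = cis (2 * 0)"
    by (simp_all add: cis_conv_exp)
  then have "cmod ((exp (\<i> * of_real (root_angle N \<sigma> s)) - exp (\<i> * of_real \<sigma>)) /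
          (exp (\<i> * of_real (root_angle N \<sigma> s)) - 1)) = cmod ((cis (2 * ?x) - cis (2 * (\<sigma> / 2))) / (cis (2 * ?x) - cis (2 * 0)))"
    by (simp only:)
  also have "\<dots> = \<bar>sin (?x - \<sigma> / 2) / sin ?x\<bar>"
    unfolding cis_double_diff by (simp add: norm_divide norm_mult)
  finally show ?thesis
    by (simp only: weight_exp_def weight_sin_def)
qed

text \<open>The shift by k pi cancels in the angle difference and changes at most the sign of the
  other sine. For \<beta> = 0 and s = 0 the sides differ: 0 by the division convention against the
  limit value.\<close>

lemma weight_exp_eq_node_weight:
  fixes \<sigma> :: real and N :: nat
  defines "\<beta> \<equiv> \<sigma> / 2 - of_int \<lfloor>\<sigma> / (2 * pi)\<rfloor> * pi"
  assumes "s \<le> N" "\<beta> \<noteq> 0 \<or> s \<noteq> 0"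
  shows "weight_exp N \<sigma> s = node_weight (N + 1) \<beta> s"
proof -
  define k where "k = \<lfloor>\<sigma> / (2 * pi)\<rfloor>"
  have angle: "root_angle N \<sigma> s / 2 = node_angle (N + 1) \<beta> s + of_int k * pi"
    unfolding root_angle_eq_node_angle[OF \<open>s \<le> N\<close>] by (simp add: \<beta>_def k_def)
  then have angle_diff: "root_angle N \<sigma> s / 2 - \<sigma> / 2 = node_angle (N + 1) \<beta> s - \<beta>"
    by (simp add: \<beta>_def k_def)
  have "weight_exp N \<sigma> s = 1 / (fact s * fact (N + 1 - s)) *
      \<bar>sin (node_angle (N + 1) \<beta> s - \<beta>) / sin (node_angle (N + 1) \<beta> s + of_int k * pi)\<bar>"
    unfolding weight_exp_eq_weight_sin weight_sin_def angle_diff unfolding angle ..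
  then show ?thesis
    using assms(3) by (auto simp: node_weight_def sin_add_int_pi)
qed

text \<open>Just to the right of \<sigma> = 2 pi k the floor stays k, so the reduced half-angle
  tends to 0 from the right.\<close>

lemma tendsto_weight_exp:
  fixes \<sigma> :: real
  assumes "\<sigma> / 2 - of_int \<lfloor>\<sigma> / (2 * pi)\<rfloor> * pi = 0" "s \<le> N"
  shows "((\<lambda>t. weight_exp N t s) \<longlongrightarrow> node_weight (N + 1) 0 s) (at_right \<sigma>)"
proof -
  define k where "k = \<lfloor>\<sigma> / (2 * pi)\<rfloor>"
  have \<sigma>: "\<sigma> = 2 * pi * of_int k"
    using assms(1) unfolding k_def[symmetric] by (simp add: field_simps)
  have lim: "((\<lambda>t. node_weight (N + 1) (t / 2) s) \<longlongrightarrow> node_weight (N + 1) 0 s) (at_right 0)"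
  proof (rule filterlim_compose[OF tendsto_node_weight])
    show "filterlim (\<lambda>t::real. t / 2) (at_right 0) (at_right 0)"
      by (auto simp: filterlim_at intro!: tendsto_eq_intros eventually_mono[OF eventually_at_right_less])
  qed (use assms in auto)
  have "eventually (\<lambda>t. t \<in> {0<..<2 * pi}) (at_right (0::real))"
    by (rule eventually_at_right_real) simp
  then have "eventually (\<lambda>t. node_weight (N + 1) (t / 2) s = weight_exp N (t + \<sigma>) s) (at_right 0)"
  proof eventually_elim
    case (elim t)
    have "(t + \<sigma>) / (2 * pi) = t / (2 * pi) + of_int k"
      by (simp add: \<sigma> field_simps)
    moreover have "0 \<le> t / (2 * pi)" "t / (2 * pi) < 1"
      using elim by (simp_all add: field_simps)
    ultimately have "\<lfloor>(t + \<sigma>) / (2 * pi)\<rfloor> = k"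
      by (simp add: floor_eq_iff)
    then have half: "(t + \<sigma>) / 2 - of_int \<lfloor>(t + \<sigma>) / (2 * pi)\<rfloor> * pi = t / 2"
      by (simp add: \<sigma> field_simps)
    show ?case
      using weight_exp_eq_node_weight[OF \<open>s \<le> N\<close>, of "t + \<sigma>", unfolded half] elim by simp
  qed
  with lim have "((\<lambda>t. weight_exp N (t + \<sigma>) s) \<longlongrightarrow> node_weight (N + 1) 0 s) (at_right 0)"
    by (rule Lim_transform_eventually)
  then show ?thesis
    by (subst filterlim_at_right_to_0)
qed

section \<open>Roots, weights and their uniqueness\<close>

theorem proposition6p2:
  fixes N :: nat and \<sigma> :: real and \<omega> :: complex and a :: "nat \<Rightarrow> complex"
  assumes "\<omega> = exp (\<i> * of_real \<sigma>)"
    and "\<omega> \<noteq> -1"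
    and "\<And>n. n \<le> N \<Longrightarrow> a n = (\<omega> + 1) / (of_nat N + 1) * (of_nat n + 1) - 1"
  shows "(\<forall>s\<le>N. \<exists>!t. root_angle_eq N \<sigma> s t) \<and>
         bij_betw (root_point N \<sigma>) {..N} {z. poly (opuc a (N + 1)) z = 0} \<and>
         (\<forall>w. opuc_orthogonality a N (root_point N \<sigma>) w \<longleftrightarrow>
              (\<forall>s\<le>N. w s = circle_weight N \<sigma> s / (\<Sum>r\<le>N. circle_weight N \<sigma> r))) \<and>
         (\<forall>s\<le>N. weight_exp N \<sigma> s = weight_sin N \<sigma> s) \<and>
         (\<forall>s\<le>N. root_point N \<sigma> s = 1 \<longrightarrow>
              ((\<lambda>t. weight_exp N t s) \<longlongrightarrow> circle_weight N \<sigma> s) (at_right \<sigma>))"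
proof -
  define k where "k = \<lfloor>\<sigma> / (2 * pi)\<rfloor>"
  define \<beta> where "\<beta> = \<sigma> / 2 - of_int k * pi"
  define W where "W = node_weight (N + 1) \<beta>"
  have \<beta>: "0 \<le> \<beta>" "\<beta> < pi"
    using half_angle_bounds[of \<sigma>] by (simp_all add: \<beta>_def k_def)
  have \<omega>: "\<omega> = cis (2 * \<beta>)"
    using exp_double_add_int_pi[of \<beta> k] assms(1) by (simp add: \<beta>_def)
  have \<omega>1: "\<omega> + 1 = 2 * of_real (cos \<beta>) * cis \<beta>"
    by (simp add: \<omega> complex_eq_iff cos_double_cos sin_double power2_eq_square)
  with assms(2) have cos: "cos \<beta> \<noteq> 0"
    by (auto simp: add_eq_0_iff2)
  have "a n = linear_verblunsky (N + 1) \<beta> n" if "n < N + 1" for n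
  proof -
    have "a n = (2 * of_real (cos \<beta>) * cis \<beta>) / (of_nat N + 1) * (of_nat n + 1) - 1"
      using assms(3) that by (simp add: \<omega>1)
    then show ?thesis by (simp add: linear_verblunsky_def add.commute)
  qed
  then have opuc_a: "opuc a n = opuc (linear_verblunsky (N + 1) \<beta>) n" if "n \<le> N + 1" for n
    using that by (intro opuc_cong) auto
  have point: "root_point N \<sigma> s = cis (2 * node_angle (N + 1) \<beta> s)" if "s \<le> N" for s
    using exp_double_add_int_pi[of "node_angle (N + 1) \<beta> s" k] root_angle_eq_node_angle[OF that, of \<sigma>]
    by (simp add: root_point_def \<beta>_def k_def)
  \<comment> \<open>The node 1 occurs exactly in the 0/0 case, so the case distinctions of
    \<open>circle_weight\<close> and \<open>node_weight\<close> agree.\<close>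
  have point_1: "root_point N \<sigma> s = 1 \<longleftrightarrow> \<beta> = 0 \<and> s = 0" if s: "s \<le> N" for s
  proof (cases "\<beta> = 0 \<and> s = 0")
    case True
    then show ?thesis
      using point[OF s] by (simp add: node_angle_def cis_2pi)
  next
    case False
    then have "0 < sin (node_angle (N + 1) \<beta> s)"
      using s \<beta> by (intro sin_node_angle_pos) auto
    then have "root_point N \<sigma> s - 1 \<noteq> 0"
      using cis_double_diff[of "node_angle (N + 1) \<beta> s" 0] point[OF s] by auto
    then show ?thesis using False by auto
  qed
  have weight: "circle_weight N \<sigma> s = W s" if s: "s \<le> N" for s
  proof (cases "\<beta> = 0 \<and> s = 0")
    case True
    then have "((\<lambda>t. weight_exp N t s) \<longlongrightarrow> W s) (at_right \<sigma>)"
      using tendsto_weight_exp[of \<sigma> s N, folded k_def, folded \<beta>_def] s by (simp add: W_def)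
    then show ?thesis
      using True point_1[OF s] by (simp add: circle_weight_def tendsto_Lim)
  next
    case False
    then show ?thesis
      using point_1[OF s] weight_exp_eq_node_weight[OF s, of \<sigma>]
      by (auto simp: circle_weight_def W_def \<beta>_def k_def)
  qed
  have unit: "cmod (root_point N \<sigma> s) = 1" if "s \<le> N" for s
    by (simp add: point that)
  have inj: "inj_on (root_point N \<sigma>) {..N}"
    using inj_on_node_points[OF \<beta> cos, of "N + 1"] point
    by (simp add: inj_on_def lessThan_Suc_atMost)
  define S where "S = (\<Sum>r\<le>N. W r)"
  have "0 < S"
    unfolding S_def using \<beta> cos by (intro sum_pos) (auto simp: W_def node_weight_pos)
  have sum_W: "(\<Sum>s\<le>N. of_real (W s / S) * poly (opuc a n) (root_point N \<sigma> s)) =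
      (if n = 0 then 1 else 0)" if n: "n \<le> N" for n
  proof -
    have "(\<Sum>s\<le>N. of_real (W s / S) * poly (opuc a n) (root_point N \<sigma> s)) =
        (\<Sum>s<N + 1. of_real (W s) * poly (opuc (linear_verblunsky (N + 1) \<beta>) n)
          (cis (2 * node_angle (N + 1) \<beta> s))) / of_real S"
      using n by (simp add: lessThan_Suc_atMost opuc_a sum_divide_distrib point)
    also have "\<dots> = (if n = 0 then 1 else 0)"
    proof (cases "n = 0")
      case True
      then show ?thesis
        using \<open>0 < S\<close> by (simp add: S_def lessThan_Suc_atMost del: sum.lessThan_Suc flip: of_real_sum)
    next
      case False
      then show ?thesis
        using sum_opuc_nodes_eq_0[OF \<beta> cos, of n "N + 1"] n by (simp add: W_def)
    qed
    finally show ?thesis .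
  qed
  have "opuc_orthogonality a N (root_point N \<sigma>) w \<longleftrightarrow> (\<forall>s\<le>N. w s = W s / S)" for w
  proof
    assume "opuc_orthogonality a N (root_point N \<sigma>) w"
    then have w: "(\<Sum>s\<le>N. of_real (w s) * poly (opuc a n) (root_point N \<sigma> s)) =
        (if n = 0 then 1 else 0)" if "n \<le> N" for n
      using that opuc_orthogonality_iff[of N "root_point N \<sigma>", OF unit] by blast
    \<comment> \<open>The difference of two weight systems annihilates \<Phi>_0, ..., \<Phi>_N on N
      + 1 distinct points.\<close>
    have "complex_of_real (w s - W s / S) = 0" if "s \<le> N" for s
      using inj that
    proof (rule opuc_sum_eq_0_imp[rotated])
      show "(\<Sum>s\<le>N. complex_of_real (w s - W s / S) * poly (opuc a n) (root_point N \<sigma> s)) = 0"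
        if "n \<le> N" for n
        unfolding of_real_diff left_diff_distrib sum_subtractf
        by (simp only: w[OF that] sum_W[OF that] diff_self)
    qed
    then show "\<forall>s\<le>N. w s = W s / S"
      by (simp only: of_real_eq_0_iff right_minus_eq) blast
  next
    assume w: "\<forall>s\<le>N. w s = W s / S"
    have "(\<Sum>s\<le>N. of_real (w s) * poly (opuc a n) (root_point N \<sigma> s)) =
        (if n = 0 then 1 else 0)" if "n \<le> N" for n
      unfolding sum_W[OF that, symmetric] using w by (intro sum.cong) auto
    then show "opuc_orthogonality a N (root_point N \<sigma>) w"
      by (intro opuc_orthogonality_iff[of N "root_point N \<sigma>", OF unit, THEN iffD2] allI impI)
  qed
  moreover have "(\<Sum>r\<le>N. circle_weight N \<sigma> r) = S"
    by (simp add: S_def weight)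
  moreover have "bij_betw (root_point N \<sigma>) {..N} {z. poly (opuc a (N + 1)) z = 0}"
  proof -
    have deg: "degree (opuc a (N + 1)) = N + 1" "opuc a (N + 1) \<noteq> 0"
      using opuc_monic[of a "N + 1"] by auto
    have "root_point N \<sigma> ` {..N} = {z. poly (opuc a (N + 1)) z = 0}"
    \<comment> \<open>N + 1 distinct roots exhaust a polynomial of degree N + 1.\<close>
    proof (rule card_subset_eq[OF poly_roots_finite[OF deg(2)]])
      show sub: "root_point N \<sigma> ` {..N} \<subseteq> {z. poly (opuc a (N + 1)) z = 0}"
        using opuc_node_eq_0[OF \<beta> cos, of _ "N + 1"] opuc_a[of "N + 1"] point by auto
      have "card (root_point N \<sigma> ` {..N}) = N + 1"
        using inj by (simp add: card_image)
      then show "card (root_point N \<sigma> ` {..N}) = card {z. poly (opuc a (N + 1)) z = 0}"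
        using card_mono[OF poly_roots_finite[OF deg(2)] sub] card_poly_roots_bound[OF deg(2)] deg(1)
        by linarith
    qed
    with inj show ?thesis by (simp add: bij_betw_def)
  qed
  moreover have "((\<lambda>t. weight_exp N t s) \<longlongrightarrow> circle_weight N \<sigma> s) (at_right \<sigma>)"
    if "s \<le> N" "root_point N \<sigma> s = 1" for s
    using tendsto_weight_exp[of \<sigma> s N, folded k_def, folded \<beta>_def] that point_1[of s] weight[of s]
    by (simp add: W_def)
  ultimately show ?thesis
    using root_angle_eq_iff[of _ N \<sigma>] weight by (auto simp: weight_exp_eq_weight_sin)
qed

end
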